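(* Let $b$ satisfy (b1)–(b4) and $u\in BV(\Omega)\cap L^\infty(\Omega)$. Then for every sequence $(u_n)\in\mathcal A(u)$, $$\int_\Omega\varphi\,d(b(\cdot,u),Du)_L\le\liminf_{n\to\infty}\int_\Omega\varphi\,d(b(\cdot,u_n),Du_n)_L\qquad\forall\varphi\in C^\infty_c(\Omega),\ \varphi\ge0.$$
   Context: $\Omega\subseteq\mathbb R^N$ ($N\ge2$) open; $\mathcal{DM}^\infty(\Omega)$ = fields $A\in L^\infty(\Omega;\mathbb R^N)$ with distributional divergence a finite Radon measure. Assumptions on $b\colon\Omega\times\mathbb R\to\mathbb R^N$: (b1) Borel and bounded; (b2) for a.e. $x$, $t\mapsto b(x,t)$ continuous; (b3) $b_t:=b(\cdot,t)\in\mathcal{DM}^\infty(\Omega)$ for all $t$; (b4) $\sigma:=\bigvee_t|\operatorname{div}_xb_t|$ (least upper bound of measures) is a finite Radon measure. $f(\cdot,t)=d\operatorname{div}_xb_t/d\sigma$, $B(x,t)=\int_0^tb(x,s)ds$, $F(x,t)=\int_0^tf(x,s)ds$. $u^\pm$: approximate upper/lower limits (defined $\mathcal H^{N-1}$-a.e., hence $\sigma$-a.e.). For $a\le b$ let $\widehat{\mathcal F}(x,a,b):=\max_{t\in[a,b]}F(x,t)$, and define the measure $(b(\cdot,u),Du)_L:=-\widehat{\mathcal F}(x,u^-(x),u^+(x))\sigma+\operatorname{div}(B(x,u(x)))$. For $u\in BV\cap L^\infty$, $\mathcal A(u)$ is the class of sequences $(u_n)\subset BV(\Omega)\cap L^\infty(\Omega)$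 such that: (i) $u_n\to u$ in $L^1(\Omega)$; (ii) $u^-(x)\le\liminf_nu_n^-(x)\le\limsup_nu_n^+(x)\le u^+(x)$ for $\sigma$-a.e. $x$; (iii) there is $g\in L^1(\Omega;\sigma)$ with $|u_n^\pm|\le g$ $\sigma$-a.e. for all $n$. *)

theory Defs
  imports "HOL-Analysis.Analysis"
begin

definition pderiv_fun :: "'n::finite \<Rightarrow> (real^'n \<Rightarrow> real) \<Rightarrow> real^'n \<Rightarrow> real" where
  "pderiv_fun i \<phi> = (\<lambda>x. frechet_derivative \<phi> (at x) (axis i 1))"

fun smooth_k :: "nat \<Rightarrow> (real^'n::finite \<Rightarrow> real) \<Rightarrow> bool" where
  "smooth_k 0 \<phi> = continuous_on UNIV \<phi>"
| "smooth_k (Suc k) \<phi> =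
     (continuous_on UNIV \<phi> \<and> \<phi> differentiable_on UNIV \<and> (\<forall>i. smooth_k k (pderiv_fun i \<phi>)))"

definition test_fun :: "(real^'n::finite) set \<Rightarrow> (real^'n \<Rightarrow> real) \<Rightarrow> bool" where
  "test_fun \<Omega> \<phi> \<longleftrightarrow> (\<forall>k. smooth_k k \<phi>) \<and> compact (closure {x. \<phi> x \<noteq> 0})
     \<and> closure {x. \<phi> x \<noteq> 0} \<subseteq> \<Omega>"

definition grad :: "(real^'n::finite \<Rightarrow> real) \<Rightarrow> real^'n \<Rightarrow> real^'n" where
  "grad \<phi> x = (\<chi> i. pderiv_fun i \<phi> x)"

definition finite_Borel_on :: "(real^'n::finite) set \<Rightarrow> (real^'n) measure \<Rightarrow> bool" where
  "finite_Borel_on \<Omega> \<mu> \<longleftrightarrow> sets \<mu> = sets (restrict_space borel \<Omega>) \<and> finite_measure \<mu>"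

definition div_polar :: "(real^'n::finite) set \<Rightarrow> (real^'n \<Rightarrow> real^'n) \<Rightarrow> (real^'n) measure
    \<Rightarrow> (real^'n \<Rightarrow> real) \<Rightarrow> bool" where
  "div_polar \<Omega> A \<nu> h \<longleftrightarrow> finite_Borel_on \<Omega> \<nu> \<and> h \<in> borel_measurable \<nu> \<and> (AE x in \<nu>. \<bar>h x\<bar> = 1) \<and>
     (\<forall>\<phi>. test_fun \<Omega> \<phi> \<longrightarrow>
        (LINT x|lebesgue_on \<Omega>. A x \<bullet> grad \<phi> x) = - (LINT x|\<nu>. \<phi> x * h x))"

text \<open>nu is the total variation measure |div A| (div A a finite Radon measure).\<close>
definition div_tv :: "(real^'n::finite) set \<Rightarrow> (real^'n \<Rightarrow> real^'n) \<Rightarrow> (real^'n) measure \<Rightarrow> bool" where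
  "div_tv \<Omega> A \<nu> \<longleftrightarrow> (\<exists>h. div_polar \<Omega> A \<nu> h)"

definition ess_bdd :: "(real^'n::finite) set \<Rightarrow> (real^'n \<Rightarrow> 'b::real_normed_vector) \<Rightarrow> bool" where
  "ess_bdd \<Omega> u \<longleftrightarrow> (\<exists>C. AE x in lebesgue_on \<Omega>. norm (u x) \<le> C)"

definition Linf :: "(real^'n::finite) set \<Rightarrow> (real^'n \<Rightarrow> 'b::real_normed_vector) \<Rightarrow> bool" where
  "Linf \<Omega> u \<longleftrightarrow> u \<in> borel_measurable (lebesgue_on \<Omega>) \<and> ess_bdd \<Omega> u"

definition DM_inf :: "(real^'n::finite) set \<Rightarrow> (real^'n \<Rightarrow> real^'n) \<Rightarrow> bool" where
  "DM_inf \<Omega> A \<longleftrightarrow> Linf \<Omega> A \<and> (\<exists>\<nu>. div_tv \<Omega> A \<nu>)"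

definition BV :: "(real^'n::finite) set \<Rightarrow> (real^'n \<Rightarrow> real) \<Rightarrow> bool" where
  "BV \<Omega> u \<longleftrightarrow> integrable (lebesgue_on \<Omega>) u \<and>
     (\<exists>\<nu> (h :: real^'n \<Rightarrow> real^'n). finite_Borel_on \<Omega> \<nu> \<and> h \<in> borel_measurable \<nu> \<and>
        (AE x in \<nu>. norm (h x) = 1) \<and>
        (\<forall>\<phi> i. test_fun \<Omega> \<phi> \<longrightarrow>
           (LINT x|lebesgue_on \<Omega>. u x * pderiv_fun i \<phi> x) = - (LINT x|\<nu>. \<phi> x * h x $ i)))"

definition lub_tv :: "(real^'n::finite) set \<Rightarrow> (real^'n \<Rightarrow> real \<Rightarrow> real^'n) \<Rightarrow> (real^'n) measure \<Rightarrow> bool" where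
  "lub_tv \<Omega> b \<sigma> \<longleftrightarrow> sets \<sigma> = sets (restrict_space borel \<Omega>) \<and>
     (\<forall>t \<nu>. div_tv \<Omega> (\<lambda>x. b x t) \<nu> \<longrightarrow> (\<forall>S\<in>sets \<sigma>. emeasure \<nu> S \<le> emeasure \<sigma> S)) \<and>
     (\<forall>\<mu>. sets \<mu> = sets \<sigma> \<and>
          (\<forall>t \<nu>. div_tv \<Omega> (\<lambda>x. b x t) \<nu> \<longrightarrow> (\<forall>S\<in>sets \<sigma>. emeasure \<nu> S \<le> emeasure \<mu> S))
        \<longrightarrow> (\<forall>S\<in>sets \<sigma>. emeasure \<sigma> S \<le> emeasure \<mu> S))"

definition RN_div_density :: "(real^'n::finite) set \<Rightarrow> (real^'n \<Rightarrow> real \<Rightarrow> real^'n) \<Rightarrow> (real^'n) measure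
    \<Rightarrow> (real^'n \<Rightarrow> real \<Rightarrow> real) \<Rightarrow> bool" where
  "RN_div_density \<Omega> b \<sigma> f \<longleftrightarrow>
     (\<lambda>(x, t). f x t) \<in> borel_measurable (restrict_space borel (\<Omega> \<times> UNIV)) \<and>
     (\<forall>t. integrable \<sigma> (\<lambda>x. f x t) \<and>
        (\<forall>\<phi>. test_fun \<Omega> \<phi> \<longrightarrow>
           (LINT x|lebesgue_on \<Omega>. b x t \<bullet> grad \<phi> x) = - (LINT x|\<sigma>. \<phi> x * f x t)))"

definition Bprim :: "(real^'n::finite \<Rightarrow> real \<Rightarrow> real^'n) \<Rightarrow> real^'n \<Rightarrow> real \<Rightarrow> real^'n" where
  "Bprim b x t = interval_lebesgue_integral lborel 0 (ereal t) (b x)"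

definition Fprim :: "(real^'n::finite \<Rightarrow> real \<Rightarrow> real) \<Rightarrow> real^'n \<Rightarrow> real \<Rightarrow> real" where
  "Fprim f x t = interval_lebesgue_integral lborel 0 (ereal t) (f x)"

definition Fhat :: "(real^'n::finite \<Rightarrow> real \<Rightarrow> real) \<Rightarrow> real^'n \<Rightarrow> real \<Rightarrow> real \<Rightarrow> real" where
  "Fhat f x a c = Sup (Fprim f x ` {a..c})"

definition ap_upper :: "(real^'n::finite) set \<Rightarrow> (real^'n \<Rightarrow> real) \<Rightarrow> real^'n \<Rightarrow> real" where
  "ap_upper \<Omega> u x = Inf {t. ((\<lambda>r. measure lebesgue ({y\<in>\<Omega>. u y > t} \<inter> ball x r)
                                   / measure lebesgue (ball x r)) \<longlongrightarrow> 0) (at_right 0)}"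

definition ap_lower :: "(real^'n::finite) set \<Rightarrow> (real^'n \<Rightarrow> real) \<Rightarrow> real^'n \<Rightarrow> real" where
  "ap_lower \<Omega> u x = Sup {t. ((\<lambda>r. measure lebesgue ({y\<in>\<Omega>. u y < t} \<inter> ball x r)
                                   / measure lebesgue (ball x r)) \<longlongrightarrow> 0) (at_right 0)}"

text \<open>Integral of phi against (b(.,u),Du)_L
  = - F^(x,u^-,u^+) sigma + div(B(x,u(x))); the divergence term tested against phi is
  -int B(x,u(x)) . grad phi dx (distributional divergence).\<close>
definition pairing_L :: "(real^'n::finite) set \<Rightarrow> (real^'n) measure \<Rightarrow> (real^'n \<Rightarrow> real \<Rightarrow> real^'n)
    \<Rightarrow> (real^'n \<Rightarrow> real \<Rightarrow> real) \<Rightarrow> (real^'n \<Rightarrow> real) \<Rightarrow> (real^'n \<Rightarrow> real) \<Rightarrow> real" where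
  "pairing_L \<Omega> \<sigma> b f u \<phi> =
     - (LINT x|\<sigma>. \<phi> x * Fhat f x (ap_lower \<Omega> u x) (ap_upper \<Omega> u x))
     - (LINT x|lebesgue_on \<Omega>. Bprim b x (u x) \<bullet> grad \<phi> x)"

definition class_A :: "(real^'n::finite) set \<Rightarrow> (real^'n) measure \<Rightarrow> (real^'n \<Rightarrow> real)
    \<Rightarrow> (nat \<Rightarrow> real^'n \<Rightarrow> real) \<Rightarrow> bool" where
  "class_A \<Omega> \<sigma> u us \<longleftrightarrow>
     (\<forall>n. BV \<Omega> (us n) \<and> Linf \<Omega> (us n)) \<and>
     ((\<lambda>n. LINT x|lebesgue_on \<Omega>. \<bar>us n x - u x\<bar>) \<longlonglongrightarrow> 0) \<and>
     (AE x in \<sigma>.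
        ereal (ap_lower \<Omega> u x) \<le> liminf (\<lambda>n. ereal (ap_lower \<Omega> (us n) x)) \<and>
        liminf (\<lambda>n. ereal (ap_lower \<Omega> (us n) x)) \<le> limsup (\<lambda>n. ereal (ap_upper \<Omega> (us n) x)) \<and>
        limsup (\<lambda>n. ereal (ap_upper \<Omega> (us n) x)) \<le> ereal (ap_upper \<Omega> u x)) \<and>
     (\<exists>g. integrable \<sigma> g \<and>
        (AE x in \<sigma>. \<forall>n. \<bar>ap_upper \<Omega> (us n) x\<bar> \<le> g x \<and> \<bar>ap_lower \<Omega> (us n) x\<bar> \<le> g x))"

end

theory Submission
  imports Defs "HOL-Computational_Algebra.Polynomial"
begin

text \<open>Since \<open>|div b\<^sub>t| \<le> \<sigma>\<close>, the density satisfies \<open>|f(x,t)| \<le> 1\<close> for \<open>\<sigma>\<close>-almost every \<open>x\<close>, and by Fubini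
  \<open>F(x,\<cdot>)\<close> is 1-Lipschitz for \<open>\<sigma>\<close>-almost every \<open>x\<close>. Hence the one-sided control of \<open>u\<^sub>n\<^sup>\<plusminus>\<close> gives that
  \<open>max (F\<^sub>n, F\<^sub>\<infinity>)\<close> converges to \<open>F\<^sub>\<infinity>\<close> almost everywhere, where \<open>F\<^sub>n\<close> and \<open>F\<^sub>\<infinity>\<close> are the maxima of \<open>F(x,\<cdot>)\<close>
  over \<open>[u\<^sub>n\<^sup>-, u\<^sub>n\<^sup>+]\<close> and \<open>[u\<^sup>-, u\<^sup>+]\<close>. Dominated convergence then bounds the \<open>\<sigma>\<close>-terms, while the
  divergence terms converge because \<open>B(x,\<cdot>)\<close> is Lipschitz uniformly in \<open>x\<close>.\<close>

section \<open>Smooth approximation of indicators of open sets\<close>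

text \<open>The density \<open>f\<close> and the polar function of the divergence are known only
  through integrals of test functions against two different measures. Before they can be compared,
  the two signed measures must be shown to agree on all Borel sets, and for this smooth
  approximations of indicators of open sets are built from exp(-1/s). The other obstacle is
  measurability. A non-measurable integrand has integral 0 by convention, and \<sigma> lives on
  Borel sets while \<open>u\<close> is only Lebesgue measurable. Limits over all radii, infima over
  all levels and maxima over intervals are therefore rewritten with rational radii, levels and
  interpolation parameters. The maximum with the limit value is forced by the one-sided control: the
  intervals of the sequence may stay strictly inside the limiting one, so their maxima need not
  converge. They enter the pairing with a minus sign, so bounding them from above is exactly what a
  lower bound on the liminf requires.\<close>

lemma pderiv_fun_eq:
  assumes "(f has_derivative f') (at x)"
  shows "pderiv_fun i f x = f' (axis i 1)"
  using frechet_derivative_at[OF assms] by (simp add: pderiv_fun_def)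

section \<open>Closure of \<open>smooth_k\<close> under algebraic operations\<close>

lemma smooth_k_SucD: "smooth_k (Suc k) f \<Longrightarrow> smooth_k k f"
  by (induction k arbitrary: f) auto

lemma smooth_k_imp_continuous: "smooth_k k f \<Longrightarrow> continuous_on UNIV f"
  by (cases k) auto

lemma smooth_k_const: "smooth_k k (\<lambda>x. c)"
proof (induction k arbitrary: c)
  case (Suc k)
  have "pderiv_fun i (\<lambda>x. c) = (\<lambda>x. 0)" for i :: 'a
    by (rule ext, subst pderiv_fun_eq[OF has_derivative_const]) simp
  with Suc show ?case by simp
qed simp

lemma smooth_k_component: "smooth_k k (\<lambda>x. x $ i)"
proof (cases k)
  case (Suc m)
  have d: "((\<lambda>x. x $ i) has_derivative (\<lambda>x. x $ i)) (at x)" for x :: "real^'a"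
    by (rule bounded_linear_imp_has_derivative[OF bounded_linear_vec_nth])
  have "pderiv_fun j (\<lambda>x. x $ i) = (\<lambda>x. axis j 1 $ i)" for j :: 'a
    by (rule ext, subst pderiv_fun_eq[OF d]) simp
  moreover have "(\<lambda>x::real^'a. x $ i) differentiable_on UNIV"
    using d differentiable_def by (auto simp: differentiable_on_def)
  ultimately show ?thesis using Suc by (simp add: smooth_k_const continuous_on_component)
qed (simp add: continuous_on_component)

lemma smooth_k_add:
  assumes "smooth_k k f" "smooth_k k g"
  shows "smooth_k k (\<lambda>x. f x + g x)"
  using assms
proof (induction k arbitrary: f g)
  case (Suc k)
  then have d: "f differentiable at x" "g differentiable at x" for x
    by (auto simp: differentiable_on_def)
  then have "pderiv_fun i (\<lambda>x. f x + g x) = (\<lambda>x. pderiv_fun i f x + pderiv_fun i g x)" for i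
    by (intro ext, subst pderiv_fun_eq[OF has_derivative_add])
      (auto simp: pderiv_fun_def frechet_derivative_works)
  with Suc d show ?case by (auto intro!: continuous_on_add differentiable_on_add)
qed (auto intro: continuous_on_add)

lemma smooth_k_mult:
  assumes "smooth_k k f" "smooth_k k g"
  shows "smooth_k k (\<lambda>x. f x * g x)"
  using assms
proof (induction k arbitrary: f g)
  case (Suc k)
  then have d: "f differentiable at x" "g differentiable at x" for x
    by (auto simp: differentiable_on_def)
  then have "pderiv_fun i (\<lambda>x. f x * g x) = (\<lambda>x. f x * pderiv_fun i g x + pderiv_fun i f x * g x)" for i
    by (intro ext, subst pderiv_fun_eq[OF has_derivative_mult])
      (auto simp: pderiv_fun_def frechet_derivative_works)
  \<comment> \<open>The Leibniz terms contain \<open>f\<close> and \<open>g\<close>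
    undifferentiated, so their smoothness is lowered from \<open>Suc k\<close> to \<open>k\<close>
    before the induction hypothesis applies.\<close>
  moreover have "smooth_k k (\<lambda>x. f x * pderiv_fun i g x + pderiv_fun i f x * g x)" for i
    using Suc.prems
    by (intro smooth_k_add Suc.IH smooth_k_SucD[OF Suc.prems(1)] smooth_k_SucD[OF Suc.prems(2)]) auto
  ultimately show ?case
    using Suc.prems by (auto intro: continuous_on_mult differentiable_on_mult)
qed (auto intro: continuous_on_mult)

lemma smooth_k_sum:
  assumes "\<And>j. j \<in> J \<Longrightarrow> smooth_k k (f j)"
  shows "smooth_k k (\<lambda>x. \<Sum>j\<in>J. f j x)"
  using assms
  by (induction J rule: infinite_finite_induct) (auto simp: smooth_k_const intro: smooth_k_add)

text \<open>Carrying the polynomial \<open>p\<close> makes the family closed under differentiation;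
  \<open>flat 1\<close> is the classical profile exp(-1/s) of bump functions.\<close>

definition flat :: "real poly \<Rightarrow> real \<Rightarrow> real" where
  "flat p s = (if s > 0 then poly p (1 / s) * exp (- (1 / s)) else 0)"

text \<open>The power \<open>y ^ k\<close> is there for the induction: removing the constant
  coefficient of the polynomial leaves an extra factor y, which is absorbed into the
  exponent.\<close>

lemma poly_mult_power_exp_tendsto_0:
  "((\<lambda>y::real. poly p y * y ^ k * exp (- y)) \<longlongrightarrow> 0) at_top"
proof (induction p arbitrary: k)
  case (pCons a p)
  have "((\<lambda>y. a * (y ^ k / exp y) + poly p y * y ^ Suc k * exp (- y)) \<longlongrightarrow> a * 0 + 0) at_top"
    by (intro tendsto_add tendsto_mult tendsto_const tendsto_power_div_exp_0 pCons.IH)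
  then show ?case by (simp add: algebra_simps exp_minus divide_inverse)
qed simp

text \<open>For s > 0 the derivative is s^(-2) (p - p')(1/s) exp(-1/s), and
  \<open>[:0, 0, 1:]\<close> is the monomial X^2. At 0 the exponential decay beats the division by
  s.\<close>

lemma has_derivative_flat:
  "(flat p has_real_derivative flat ([:0, 0, 1:] * (p - pderiv p)) s) (at s)"
proof -
  consider "s > 0" | "s < 0" | "s = 0" by linarith
  then show ?thesis
  proof cases
    case 1
    have "((\<lambda>s. poly p (1 / s) * exp (- (1 / s))) has_real_derivative
             flat ([:0, 0, 1:] * (p - pderiv p)) s) (at s)"
      using 1 by (auto intro!: derivative_eq_intros simp: flat_def field_simps power2_eq_square)
    moreover have "eventually (\<lambda>s. flat p s = poly p (1 / s) * exp (- (1 / s))) (nhds s)"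
      using eventually_nhds_in_open[of "{0<..}" s] 1
      by (auto simp: flat_def elim!: eventually_mono)
    ultimately show ?thesis by (subst DERIV_cong_ev[OF refl _ refl])
  next
    case 2
    have "eventually (\<lambda>s. flat p s = 0) (nhds s)"
      using eventually_nhds_in_open[of "{..<0}" s] 2
      by (auto simp: flat_def elim!: eventually_mono)
    moreover have "((\<lambda>s. 0) has_real_derivative flat ([:0, 0, 1:] * (p - pderiv p)) s) (at s)"
      using 2 by (auto simp: flat_def)
    ultimately show ?thesis by (subst DERIV_cong_ev[OF refl _ refl])
  next
    case 3
    \<comment> \<open>With y = 1/s the difference quotient at 0 is p(y) y exp(-y), whence the
      exponent 1.\<close>
    have "((\<lambda>s. poly p (inverse s) * inverse s ^ 1 * exp (- inverse s)) \<longlongrightarrow> 0) (at_right 0)"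
      by (rule filterlim_compose[OF poly_mult_power_exp_tendsto_0 filterlim_inverse_at_top_right])
    moreover have "eventually (\<lambda>s. poly p (inverse s) * inverse s ^ 1 * exp (- inverse s) = flat p s / s) (at_right 0)"
      by (auto simp: eventually_at_filter flat_def field_simps)
    ultimately have "((\<lambda>s. flat p s / s) \<longlongrightarrow> 0) (at_right 0)"
      using tendsto_cong by fast
    moreover have "((\<lambda>s. flat p s / s) \<longlongrightarrow> 0) (at_left 0)"
      by (rule tendsto_eventually) (auto simp: eventually_at_filter flat_def)
    ultimately show ?thesis using 3
      by (simp add: has_field_derivative_iff filterlim_split_at) (simp add: flat_def filterlim_split_at)
  qed
qed

text \<open>Induction for all \<open>p\<close> at once: by the chain rule a partial derivative is
  another flat function of \<open>q\<close> times a partial derivative of \<open>q\<close>.\<close>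

lemma smooth_k_flat:
  assumes "\<And>m. smooth_k m q"
  shows "smooth_k k (\<lambda>x. flat p (q x))"
proof (induction k arbitrary: p)
  case 0
  have "continuous_on UNIV (flat p)"
    by (meson DERIV_isCont continuous_at_imp_continuous_on has_derivative_flat)
  then show ?case
    using smooth_k_imp_continuous[OF assms] continuous_on_compose2 by fastforce
next
  case (Suc k)
  have c: "continuous_on UNIV (\<lambda>x. flat p (q x))"
    using smooth_k_imp_continuous[OF Suc] by simp
  have "smooth_k (Suc 0) q" by (rule assms)
  then have q: "(q has_derivative frechet_derivative q (at x)) (at x)" for x
    by (auto simp: differentiable_on_def frechet_derivative_works)
  define d where "d x = (*) (flat ([:0, 0, 1:] * (p - pderiv p)) (q x)) \<circ> frechet_derivative q (at x)" for x
  have d: "((\<lambda>x. flat p (q x)) has_derivative d x) (at x)" for x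
    using diff_chain_at[OF q[of x] has_derivative_flat[unfolded has_field_derivative_def]]
    by (simp add: o_def d_def)
  then have "(\<lambda>x. flat p (q x)) differentiable_on UNIV"
    by (auto simp: differentiable_on_def differentiable_def)
  moreover have "smooth_k k (pderiv_fun i (\<lambda>x. flat p (q x)))" for i
  proof -
    have "pderiv_fun i (\<lambda>x. flat p (q x)) =
        (\<lambda>x. flat ([:0, 0, 1:] * (p - pderiv p)) (q x) * pderiv_fun i q x)"
      by (rule ext, subst pderiv_fun_eq[OF d]) (simp add: d_def pderiv_fun_def)
    moreover have "smooth_k (Suc k) q" by (rule assms)
    ultimately show ?thesis
      by (simp only: smooth_k.simps) (intro smooth_k_mult Suc.IH, auto)
  qed
  ultimately show ?case using c by simp
qed

lemma flat_1_pos_iff: "flat 1 s > 0 \<longleftrightarrow> s > 0"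
  and flat_1_nonneg: "flat 1 s \<ge> 0"
  and flat_1_le_1: "flat 1 s \<le> 1"
  by (auto simp: flat_def)

lemma smooth_ball_function:
  obtains \<rho> :: "real^'n::finite \<Rightarrow> real" where
    "\<And>k. smooth_k k \<rho>" "\<And>x. \<rho> x \<ge> 0" "\<And>x. \<rho> x > 0 \<longleftrightarrow> x \<in> ball c r"
proof (cases "r > 0")
  case True
  \<comment> \<open>This is r^2 - |x - c|^2, written with sums and products only, so that the
    closure rules of \<open>smooth_k\<close> apply literally.\<close>
  define q where "q x = r\<^sup>2 + (\<Sum>i\<in>UNIV. (- 1) * ((x $ i + - c $ i) * (x $ i + - c $ i)))" for x :: "real^'n"
  have q: "q x = r\<^sup>2 - (dist c x)\<^sup>2" for x
    by (subst dist_commute) (simp add: q_def dist_norm norm_eq_sqrt_inner inner_vec_def sum_negf sum_nonneg algebra_simps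
        flip: power2_eq_square)
  have "smooth_k k q" for k
    unfolding q_def by (intro smooth_k_add smooth_k_sum smooth_k_mult smooth_k_const smooth_k_component)
  moreover have "q x > 0 \<longleftrightarrow> x \<in> ball c r" for x
    using True abs_le_square_iff[of r "dist c x"] by (simp add: q flip: not_le)
  ultimately show ?thesis
    by (intro that[of "\<lambda>x. flat 1 (q x)"]) (auto simp: smooth_k_flat flat_1_pos_iff flat_1_nonneg)
next
  \<comment> \<open>For r \<le> 0 the ball is empty, but r^2 would not see the sign of r.\<close>
  case False
  then show ?thesis by (intro that[of "\<lambda>_. 0"]) (auto simp: smooth_k_const dest: le_less_trans[OF zero_le_dist])
qed

text \<open>Countably many balls whose closed balls lie in \<open>U\<close> cover it, and
  \<open>flat 1\<close> is applied to k times the sum of the first k ball functions. The support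
  lies in finitely many closed balls, so it is compact. At a point of \<open>U\<close> the argument
  tends to infinity and exp(-1/q) to 1; outside \<open>U\<close> it is 0.\<close>

lemma test_fun_approx_indicator:
  fixes U :: "(real^'n::finite) set"
  assumes "open U"
  obtains \<theta> where "\<And>k::nat. test_fun U (\<theta> k)" "\<And>k x. 0 \<le> \<theta> k x" "\<And>k x. \<theta> k x \<le> 1"
    "\<And>x. (\<lambda>k. \<theta> k x) \<longlonglongrightarrow> indicator U x"
proof -
  define G where "G = {ball c r |c r. cball c r \<subseteq> U}"
  have "\<And>S. S \<in> G \<Longrightarrow> open S" by (auto simp: G_def)
  then obtain G' where G': "G' \<subseteq> G" "countable G'" "\<Union>G' = \<Union>G" by (rule Lindelof)
  have UG: "\<Union>G = U"
  proof
    show "\<Union>G \<subseteq> U" using ball_subset_cball by (fastforce simp: G_def)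
    show "U \<subseteq> \<Union>G"
    proof
      fix x assume "x \<in> U"
      with assms obtain r where "r > 0" "cball x r \<subseteq> U" using open_contains_cball by blast
      then show "x \<in> \<Union>G" by (auto simp: G_def intro!: exI[of _ "ball x r"] centre_in_ball[THEN iffD2])
    qed
  qed
  \<comment> \<open>The empty ball makes the family nonempty even for empty \<open>U\<close>, so
    that \<open>from_nat_into\<close> enumerates exactly \<open>H\<close>.\<close>
  define H where "H = insert (ball 0 (- 1)) G'"
  have "cball (0::real^'n) (- 1) \<subseteq> U" by simp
  then have "ball 0 (- 1) \<in> G" unfolding G_def by blast
  then have H: "H \<subseteq> G" "\<Union>H = U" "countable H" "H \<noteq> {}" using G' UG by (auto simp: H_def)
  define S where "S = from_nat_into H"
  have rS: "range S = H" using H by (simp add: S_def)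
  have "\<exists>c r. S j = ball c r \<and> cball c r \<subseteq> U" for j
    using rS H(1) unfolding G_def by blast
  then obtain c r where cr: "\<And>j. S j = ball (c j) (r j)" "\<And>j. cball (c j) (r j) \<subseteq> U" by metis
  have "\<exists>\<rho>. (\<forall>k. smooth_k k \<rho>) \<and> (\<forall>x. \<rho> x \<ge> 0) \<and> (\<forall>x. \<rho> x > 0 \<longleftrightarrow> x \<in> S j)" for j
    unfolding cr(1) by (rule smooth_ball_function[of "c j" "r j"]) blast
  then obtain \<rho> where \<rho>: "\<And>j k. smooth_k k (\<rho> j)" "\<And>j x. \<rho> j x \<ge> 0" "\<And>j x. \<rho> j x > 0 \<longleftrightarrow> x \<in> S j"
    by metis
  define q where "q k x = real k * (\<Sum>j<k. \<rho> j x)" for k x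
  define \<theta> where "\<theta> k x = flat 1 (q k x)" for k x
  have qpos: "\<exists>j<k. x \<in> S j" if "q k x > 0" for k x
    using that \<rho>(2,3) by (metis lessThan_iff mult_zero_right not_less_iff_gr_or_eq order_le_less q_def sum.neutral)
  have "smooth_k m (q k)" for m k
    unfolding q_def by (intro smooth_k_mult smooth_k_const smooth_k_sum \<rho>)
  then have sm: "smooth_k m (\<theta> k)" for m k unfolding \<theta>_def by (rule smooth_k_flat)
  have supp: "closure {x. \<theta> k x \<noteq> 0} \<subseteq> (\<Union>j<k. cball (c j) (r j))" for k
  proof (rule closure_minimal)
    show "{x. \<theta> k x \<noteq> 0} \<subseteq> (\<Union>j<k. cball (c j) (r j))"
    proof safe
      fix x assume "\<theta> k x \<noteq> 0"
      then have "q k x > 0" by (auto simp: \<theta>_def flat_def split: if_splits)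
      then obtain j where "j < k" "x \<in> S j" using qpos by blast
      then show "x \<in> (\<Union>j<k. cball (c j) (r j))" using cr(1) ball_subset_cball by blast
    qed
  qed (auto intro: closed_UN)
  have "test_fun U (\<theta> k)" for k
    unfolding test_fun_def
  proof (intro conjI allI sm)
    have "compact (\<Union>j<k. cball (c j) (r j))" by (intro compact_UN) auto
    then show "compact (closure {x. \<theta> k x \<noteq> 0})"
      using compact_Int_closed[OF _ closed_closure[of "{x. \<theta> k x \<noteq> 0}"]]
      by (subst Int_absorb1[OF supp, symmetric])
    show "closure {x. \<theta> k x \<noteq> 0} \<subseteq> U"
      by (rule order_trans[OF supp UN_least[OF cr(2)]])
  qed
  moreover have "(\<lambda>k. \<theta> k x) \<longlonglongrightarrow> indicator U x" for x
  proof (cases "x \<in> U")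
    case True
    then obtain T where "T \<in> range S" "x \<in> T" using H(2) rS by auto
    then obtain j where "x \<in> S j" by blast
    then have j: "\<rho> j x > 0" using \<rho> by blast
    have "filterlim (\<lambda>k. \<rho> j x * real k) at_top sequentially"
      using filterlim_tendsto_pos_mult_at_top[OF tendsto_const j filterlim_real_sequentially] .
    moreover have "eventually (\<lambda>k. \<rho> j x * real k \<le> q k x) sequentially"
      using eventually_gt_at_top[of j]
    proof eventually_elim
      case (elim k)
      have "\<rho> j x \<le> (\<Sum>j<k. \<rho> j x)" using elim \<rho>(2) by (intro member_le_sum) auto
      then show ?case by (simp add: q_def mult.commute mult_left_mono)
    qed
    ultimately have q: "filterlim (\<lambda>k. q k x) at_top sequentially" by (rule filterlim_at_top_mono)
    have "((\<lambda>k. exp (- inverse (q k x))) \<longlongrightarrow> exp (- 0)) sequentially"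
      by (intro tendsto_intros tendsto_inverse_0_at_top q)
    moreover have "eventually (\<lambda>k. exp (- inverse (q k x)) = \<theta> k x) sequentially"
      using q[unfolded filterlim_at_top_dense, rule_format, of 0]
      by eventually_elim (simp add: \<theta>_def flat_def divide_inverse)
    ultimately show ?thesis using True by (simp add: tendsto_cong)
  next
    case False
    then have "\<not> q k x > 0" for k using qpos H(2) rS by blast
    then have "\<theta> k x = 0" for k by (simp add: \<theta>_def flat_def)
    then show ?thesis using False by simp
  qed
  ultimately show ?thesis
    by (intro that[of \<theta>]) (auto simp: \<theta>_def flat_1_nonneg flat_1_le_1)
qed

section \<open>The bound on the density of the divergence\<close>

lemma test_fun_mono: "test_fun U \<phi> \<Longrightarrow> U \<subseteq> V \<Longrightarrow> test_fun V \<phi>"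
  by (auto simp: test_fun_def)

lemma continuous_on_test_fun: "test_fun U \<phi> \<Longrightarrow> continuous_on UNIV \<phi>"
  by (auto simp: test_fun_def intro: smooth_k_imp_continuous)

lemma continuous_imp_measurable_restrict_borel:
  assumes "sets M = sets (restrict_space borel \<Omega>)" "continuous_on UNIV \<phi>"
  shows "\<phi> \<in> borel_measurable M"
  using measurable_restrict_space1[OF borel_measurable_continuous_onI[OF assms(2)]]
  by (simp cong: measurable_cong_sets add: assms(1))

text \<open>Provides an intersection-stable generator for a Dynkin argument.\<close>

lemma sets_restrict_borel_open:
  assumes "open \<Omega>"
  shows "sets (restrict_space borel \<Omega>) = sigma_sets \<Omega> {U. open U \<and> U \<subseteq> \<Omega>}"
proof -
  have "\<Omega> \<in> sigma_sets UNIV (Collect open)" using assms by auto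
  from sigma_sets_Int[OF this] have "(\<inter>) \<Omega> ` sigma_sets UNIV (Collect open) = sigma_sets \<Omega> ((\<inter>) \<Omega> ` Collect open)"
    by simp
  moreover have "(\<inter>) \<Omega> ` Collect open = {U. open U \<and> U \<subseteq> \<Omega>}"
    using assms by (auto simp: image_iff)
  ultimately show ?thesis by (simp add: sets_restrict_space borel_def)
qed

text \<open>The signed measures h \<nu> and g \<sigma> coincide although \<nu> and \<sigma> differ.
  On open sets the indicator is approximated by test functions under dominated convergence;
  countable additivity of both set integrals then carries equality from this generator to all Borel
  subsets.\<close>

lemma integral_test_fun_determines_set_integral:
  fixes h g :: "real^'n::finite \<Rightarrow> real"
  assumes \<Omega>: "open \<Omega>"
    and sets: "sets \<nu> = sets (restrict_space borel \<Omega>)" "sets \<sigma> = sets (restrict_space borel \<Omega>)"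
    and int: "integrable \<nu> h" "integrable \<sigma> g"
    and eq: "\<And>\<phi>. test_fun \<Omega> \<phi> \<Longrightarrow> (LINT x|\<nu>. \<phi> x * h x) = (LINT x|\<sigma>. \<phi> x * g x)"
    and S: "S \<in> sets \<sigma>"
  shows "(LINT x:S|\<nu>. h x) = (LINT x:S|\<sigma>. g x)"
proof -
  have basic: "(LINT x:U|\<nu>. h x) = (LINT x:U|\<sigma>. g x)" if U: "open U" "U \<subseteq> \<Omega>" for U
  proof -
    obtain \<theta> where \<theta>: "\<And>k::nat. test_fun U (\<theta> k)" "\<And>k x. 0 \<le> \<theta> k x" "\<And>k x. \<theta> k x \<le> 1"
      "\<And>x. (\<lambda>k. \<theta> k x) \<longlonglongrightarrow> indicator U x"
      using test_fun_approx_indicator[OF U(1)] by blast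
    have UM: "U \<in> sets (restrict_space borel \<Omega>)"
      using U \<Omega> by (auto simp: sets_restrict_space image_iff intro!: bexI[of _ U])
    have *: "(\<lambda>k. LINT x|M. \<theta> k x * w x) \<longlonglongrightarrow> (LINT x:U|M. w x)"
      if M: "sets M = sets (restrict_space borel \<Omega>)" and w: "integrable M w" for M and w :: "real^'n \<Rightarrow> real"
      unfolding set_lebesgue_integral_def
    proof (rule integral_dominated_convergence[where w="\<lambda>x. \<bar>w x\<bar>"])
      note [measurable] = borel_measurable_integrable[OF w]
      have [measurable]: "U \<in> sets M" using UM M by simp
      show "(\<lambda>x. indicator U x *\<^sub>R w x) \<in> borel_measurable M" by measurable
      have [measurable]: "\<theta> k \<in> borel_measurable M" for k
        by (intro continuous_imp_measurable_restrict_borel[OF M] continuous_on_test_fun[OF \<theta>(1)])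
      show "(\<lambda>x. \<theta> k x * w x) \<in> borel_measurable M" for k by measurable
      show "AE x in M. (\<lambda>k. \<theta> k x * w x) \<longlonglongrightarrow> indicator U x *\<^sub>R w x"
        using \<theta>(4) by (auto intro!: tendsto_mult)
      show "AE x in M. norm (\<theta> k x * w x) \<le> \<bar>w x\<bar>" for k
        using \<theta>(2,3) by (auto simp: abs_mult intro!: mult_left_le_one_le)
    qed (use w in auto)
    have "(LINT x|\<nu>. \<theta> k x * h x) = (LINT x|\<sigma>. \<theta> k x * g x)" for k
      by (intro eq test_fun_mono[OF \<theta>(1)] U)
    then show ?thesis
      using *[OF sets(1) int(1)] *[OF sets(2) int(2)] by (simp add: LIMSEQ_unique)
  qed
  have sp: "space \<nu> = \<Omega>" "space \<sigma> = \<Omega>"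
    using sets by (auto dest: sets_eq_imp_space_eq simp: space_restrict_space)
  have si: "set_integrable \<nu> T h" "set_integrable \<sigma> T g" if "T \<in> sets \<sigma>" for T
    unfolding set_integrable_def using that int sets by (intro integrable_mult_indicator; simp)+
  have sig: "sets \<sigma> = sigma_sets \<Omega> {U. open U \<and> U \<subseteq> \<Omega>}"
    using sets sets_restrict_borel_open[OF \<Omega>] by simp
  have "Int_stable {U. open U \<and> U \<subseteq> \<Omega>}" by (auto simp: Int_stable_def)
  moreover have "{U. open U \<and> U \<subseteq> \<Omega>} \<subseteq> Pow \<Omega>" by auto
  moreover have "S \<in> sigma_sets \<Omega> {U. open U \<and> U \<subseteq> \<Omega>}" using S sig by simp
  ultimately show ?thesis
  proof (induction rule: sigma_sets_induct_disjoint)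
    case (compl T)
    then have T: "T \<in> sets \<sigma>" "T \<in> sets \<nu>" using sig sets by auto
    have "T \<subseteq> \<Omega>" using sets.sets_into_space[OF T(1)] sp by simp
    have "(LINT x:\<Omega> - T|M. w x) = (LINT x:\<Omega>|M. w x) - (LINT x:T|M. w x)"
      if "set_integrable M T w" "set_integrable M (\<Omega> - T) w" for M and w :: "real^'n \<Rightarrow> real"
      using set_integral_Un[of T "\<Omega> - T" M w] that \<open>T \<subseteq> \<Omega>\<close> by (simp add: Un_absorb1)
    moreover have "\<Omega> - T \<in> sets \<sigma>" using T(1) sp by (metis sets.compl_sets)
    ultimately show ?case using si T compl.IH basic[of \<Omega>] \<Omega> by simp
  next
    case (union T)
    then have T: "T i \<in> sets \<sigma>" "T i \<in> sets \<nu>" for i using sig sets by auto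
    then have "set_integrable \<nu> (\<Union>i. T i) h" "set_integrable \<sigma> (\<Union>i. T i) g" by (auto intro!: si)
    then show ?case
      using lebesgue_integral_countable_add[of T \<nu> h] lebesgue_integral_countable_add[of T \<sigma> g] T union
      by (auto simp: disjoint_family_on_def)
  qed (use basic in auto)
qed

text \<open>On the set S where g > 1, the integral of g equals that of h against \<nu>, which is at
  most \<nu>(S) \<le> \<sigma>(S). So g - 1, positive on S, has nonpositive integral there, and S is
  null.\<close>

lemma AE_le_1_if_set_integral_le:
  fixes h g :: "'a \<Rightarrow> real"
  assumes "finite_measure \<nu>" "finite_measure \<sigma>" and sets: "sets \<nu> = sets \<sigma>"
    and int: "integrable \<nu> h" "integrable \<sigma> g"
    and h: "AE x in \<nu>. h x \<le> 1"
    and le: "\<And>S. S \<in> sets \<sigma> \<Longrightarrow> emeasure \<nu> S \<le> emeasure \<sigma> S"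
    and eq: "\<And>S. S \<in> sets \<sigma> \<Longrightarrow> (LINT x:S|\<nu>. h x) = (LINT x:S|\<sigma>. g x)"
  shows "AE x in \<sigma>. g x \<le> 1"
proof -
  interpret \<nu>: finite_measure \<nu> by fact
  interpret \<sigma>: finite_measure \<sigma> by fact
  note [measurable] = borel_measurable_integrable[OF int(2)]
  define S where "S = {x \<in> space \<sigma>. g x > 1}"
  have S[measurable]: "S \<in> sets \<sigma>" unfolding S_def by measurable
  then have S': "S \<in> sets \<nu>" using sets by simp
  have "(LINT x:S|\<sigma>. g x) = (LINT x:S|\<nu>. h x)" using eq[OF S] by simp
  also have "\<dots> \<le> (LINT x:S|\<nu>. 1)"
    unfolding set_lebesgue_integral_def
    using h int(1) S' by (intro integral_mono_AE integrable_mult_indicator) (auto split: split_indicator)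
  also have "\<dots> = measure \<nu> S" using S' by (simp add: set_lebesgue_integral_def)
  also have "\<dots> \<le> measure \<sigma> S"
    using le[OF S] by (simp add: \<nu>.emeasure_eq_measure \<sigma>.emeasure_eq_measure)
  also have "\<dots> = (LINT x:S|\<sigma>. 1)" using S by (simp add: set_lebesgue_integral_def)
  finally have "(LINT x:S|\<sigma>. g x) - (LINT x:S|\<sigma>. 1) \<le> 0" by simp
  moreover have si: "set_integrable \<sigma> S g" "set_integrable \<sigma> S (\<lambda>_. 1::real)"
    unfolding set_integrable_def using int(2) S by (intro integrable_mult_indicator; simp)+
  ultimately have le0: "(LINT x:S|\<sigma>. g x - 1) \<le> 0" by (simp add: set_integral_diff)
  have nn: "0 \<le> indicator S x *\<^sub>R (g x - 1)" for x by (auto simp: S_def split: split_indicator)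
  with le0 have "(LINT x|\<sigma>. indicator S x *\<^sub>R (g x - 1)) = 0"
    unfolding set_lebesgue_integral_def by (intro antisym integral_nonneg_AE) auto
  moreover have "integrable \<sigma> (\<lambda>x. indicator S x *\<^sub>R (g x - 1))"
    using set_integral_diff(1)[OF si] by (simp add: set_integrable_def)
  ultimately have "AE x in \<sigma>. indicator S x *\<^sub>R (g x - 1) = 0"
    using integral_nonneg_eq_0_iff_AE[of \<sigma> "\<lambda>x. indicator S x *\<^sub>R (g x - 1)"] nn by simp
  then show ?thesis
    using AE_space by eventually_elim (auto simp: S_def indicator_def split: if_splits)
qed

text \<open>The polar function h has absolute value 1, so the one-sided bound applies both to (h, g)
  and to (-h, -g).\<close>

lemma div_density_abs_le_1:
  fixes g :: "real^'n::finite \<Rightarrow> real"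
  assumes \<Omega>: "open \<Omega>" and \<sigma>: "finite_measure \<sigma>" "sets \<sigma> = sets (restrict_space borel \<Omega>)"
    and \<nu>: "div_polar \<Omega> A \<nu> h" "\<And>S. S \<in> sets \<sigma> \<Longrightarrow> emeasure \<nu> S \<le> emeasure \<sigma> S"
    and g: "integrable \<sigma> g"
      "\<And>\<phi>. test_fun \<Omega> \<phi> \<Longrightarrow> (LINT x|lebesgue_on \<Omega>. A x \<bullet> grad \<phi> x) = - (LINT x|\<sigma>. \<phi> x * g x)"
  shows "AE x in \<sigma>. \<bar>g x\<bar> \<le> 1"
proof -
  have fin: "finite_measure \<nu>" and s: "sets \<nu> = sets (restrict_space borel \<Omega>)"
    and h: "h \<in> borel_measurable \<nu>" "AE x in \<nu>. \<bar>h x\<bar> = 1"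
    using \<nu>(1) by (auto simp: div_polar_def finite_Borel_on_def)
  have hi: "integrable \<nu> h"
    by (rule finite_measure.integrable_const_bound[OF fin _ h(1), of 1]) (use h(2) in auto)
  have t: "(LINT x|\<nu>. \<phi> x * h x) = (LINT x|\<sigma>. \<phi> x * g x)" if "test_fun \<Omega> \<phi>" for \<phi>
    using \<nu>(1) g(2)[OF that] that by (simp add: div_polar_def)
  have eq: "(LINT x:S|\<nu>. h x) = (LINT x:S|\<sigma>. g x)" if "S \<in> sets \<sigma>" for S
    by (rule integral_test_fun_determines_set_integral[OF \<Omega> s \<sigma>(2) hi g(1) t that])
  have "AE x in \<sigma>. g x \<le> 1"
    using h(2) by (intro AE_le_1_if_set_integral_le[OF fin \<sigma>(1) _ hi g(1) _ \<nu>(2) eq]) (auto simp: s \<sigma>)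
  moreover have "AE x in \<sigma>. - g x \<le> 1"
    using h(2) hi g(1) eq
    by (intro AE_le_1_if_set_integral_le[OF fin \<sigma>(1) _ _ _ _ \<nu>(2), where h="\<lambda>x. - h x"])
      (auto simp: s \<sigma> set_integral_uminus set_lebesgue_integral_def)
  ultimately show ?thesis by eventually_elim auto
qed

section \<open>Approximate limits\<close>

lemma lebesgue_on_superlevel_set:
  fixes u :: "'a::euclidean_space \<Rightarrow> real"
  assumes "u \<in> borel_measurable (lebesgue_on \<Omega>)" "open \<Omega>"
  shows "{y \<in> \<Omega>. u y > t} \<in> sets lebesgue"
proof -
  have "{y \<in> space (lebesgue_on \<Omega>). u y > t} \<in> sets (lebesgue_on \<Omega>)"
    by (rule borel_measurable_less[OF borel_measurable_const assms(1)])
  moreover have "\<Omega> \<in> sets lebesgue" using assms(2) by auto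
  ultimately show ?thesis by (simp add: space_restrict_space sets_restrict_space_iff)
qed

text \<open>An open ball is the increasing union of smaller concentric balls, so continuity from
  below applies.\<close>

lemma measure_ball_Int_lsc:
  fixes E :: "'a::euclidean_space set"
  assumes E: "E \<in> sets lebesgue" and "measure lebesgue (E \<inter> ball x r) > c"
  obtains s where "s < r" "measure lebesgue (E \<inter> ball x s) > c"
proof -
  define s where "s n = r - inverse (real (Suc n))" for n
  have "(\<lambda>n. measure lebesgue (E \<inter> ball x (s n))) \<longlonglongrightarrow> measure lebesgue (\<Union>n. E \<inter> ball x (s n))"
  proof (rule Lim_measure_incseq)
    show "range (\<lambda>n. E \<inter> ball x (s n)) \<subseteq> sets lebesgue" using E by auto
    show "incseq (\<lambda>n. E \<inter> ball x (s n))"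
      unfolding s_def by (intro incseq_SucI Int_mono subset_refl subset_ball) (simp add: field_simps)
    have "emeasure lebesgue (\<Union>n. E \<inter> ball x (s n)) \<le> emeasure lebesgue (ball x r)"
    proof (rule emeasure_mono)
      have "ball x (s n) \<subseteq> ball x r" for n by (intro subset_ball) (simp add: s_def)
      then show "(\<Union>n. E \<inter> ball x (s n)) \<subseteq> ball x r" by blast
    qed auto
    then show "emeasure lebesgue (\<Union>n. E \<inter> ball x (s n)) \<noteq> \<infinity>"
      using emeasure_bounded_finite[OF bounded_ball, of x r] by (auto simp: top_unique)
  qed
  moreover have "(\<Union>n. E \<inter> ball x (s n)) = E \<inter> ball x r"
  proof -
    have "\<exists>n. dist x y < s n" if "dist x y < r" for y
      using reals_Archimedean[of "r - dist x y"] that by (auto simp: s_def algebra_simps)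
    moreover have "s n < r" for n by (simp add: s_def)
    ultimately show ?thesis by (fastforce intro: less_trans)
  qed
  ultimately have "eventually (\<lambda>n. measure lebesgue (E \<inter> ball x (s n)) > c) sequentially"
    using assms(2) by (simp add: order_tendstoD(1))
  then obtain n where "measure lebesgue (E \<inter> ball x (s n)) > c"
    using eventually_happens'[OF sequentially_bot] by blast
  then show ?thesis by (intro that[of "s n"]) (auto simp: s_def)
qed

lemma lmeasurable_Int_ball:
  fixes E :: "'a::euclidean_space set"
  shows "E \<in> sets lebesgue \<Longrightarrow> E \<inter> ball x r \<in> lmeasurable"
  by (subst Int_commute) (simp add: fmeasurable_Int_fmeasurable)

lemma measure_Int_ball_mono:
  fixes E :: "'a::euclidean_space set"
  assumes "E \<in> sets lebesgue" "ball x s \<subseteq> ball y r"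
  shows "measure lebesgue (E \<inter> ball x s) \<le> measure lebesgue (E \<inter> ball y r)"
  using assms by (intro measure_mono_fmeasurable lmeasurable_Int_ball) auto

text \<open>Superlevel sets are open: a slightly smaller concentric ball still has measure above
  \<open>c\<close> and stays inside the ball of radius \<open>r\<close> about any nearby centre. So
  the function is Borel although \<open>E\<close> is only Lebesgue measurable.\<close>

lemma borel_measurable_measure_Int_ball:
  fixes E :: "'a::euclidean_space set"
  assumes E: "E \<in> sets lebesgue"
  shows "(\<lambda>x. measure lebesgue (E \<inter> ball x r)) \<in> borel_measurable borel"
proof (rule borel_measurableI_greater)
  fix c
  have "open {x. c < measure lebesgue (E \<inter> ball x r)}"
    unfolding open_contains_ball
  proof safe
    fix x assume "c < measure lebesgue (E \<inter> ball x r)"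
    then obtain s where s: "s < r" "c < measure lebesgue (E \<inter> ball x s)"
      using measure_ball_Int_lsc[OF E] by metis
    have "c < measure lebesgue (E \<inter> ball y r)" if "dist x y < r - s" for y
    proof -
      have "ball x s \<subseteq> ball y r"
        using that by (intro subsetI) (simp, metric)
      then show ?thesis using s measure_Int_ball_mono[OF E] by (meson less_le_trans)
    qed
    with s show "\<exists>e>0. ball x e \<subseteq> {x. c < measure lebesgue (E \<inter> ball x r)}"
      by (intro exI[of _ "r - s"]) auto
  qed
  then show "{x \<in> space borel. c < measure lebesgue (E \<inter> ball x r)} \<in> sets borel" by auto
qed

definition zero_density :: "(real^'n::finite) set \<Rightarrow> real^'n \<Rightarrow> bool" where
  "zero_density E x \<longleftrightarrow>
     ((\<lambda>r. measure lebesgue (E \<inter> ball x r) / measure lebesgue (ball x r)) \<longlongrightarrow> 0) (at_right 0)"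

lemma measure_lebesgue_ball_pos: "r > 0 \<Longrightarrow> measure lebesgue (ball (x::real^'n::finite) r) > 0"
  using content_ball_pos[of r x] by simp

text \<open>Rational radii suffice because the measures of balls are continuous from below in the radius.\<close>
lemma zero_density_iff_countable:
  fixes E :: "(real^'n::finite) set"
  assumes E: "E \<in> sets lebesgue"
  shows "zero_density E x \<longleftrightarrow> (\<forall>m. \<exists>k. \<forall>q::rat. 0 < q \<and> real_of_rat q < inverse (real (Suc k)) \<longrightarrow>
     measure lebesgue (E \<inter> ball x (real_of_rat q)) \<le>
     inverse (real (Suc m)) * measure lebesgue (ball x (real_of_rat q)))"
    (is "_ \<longleftrightarrow> ?R")
proof
  assume "zero_density E x"
  then have l: "((\<lambda>r. measure lebesgue (E \<inter> ball x r) / measure lebesgue (ball x r)) \<longlongrightarrow> 0) (at_right 0)"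
    by (simp add: zero_density_def)
  show ?R
  proof
    fix m
    have "eventually (\<lambda>r. measure lebesgue (E \<inter> ball x r) / measure lebesgue (ball x r) < inverse (real (Suc m))) (at_right 0)"
      using order_tendstoD(2)[OF l, of "inverse (real (Suc m))"] by simp
    then obtain d where d: "d > 0" "\<And>r. 0 < r \<Longrightarrow> r < d \<Longrightarrow>
        measure lebesgue (E \<inter> ball x r) / measure lebesgue (ball x r) < inverse (real (Suc m))"
      unfolding eventually_at_right_field by auto
    obtain k where "inverse (real (Suc k)) < d" using reals_Archimedean[OF d(1)] by auto
    then have "measure lebesgue (E \<inter> ball x (real_of_rat q)) \<le>
       inverse (real (Suc m)) * measure lebesgue (ball x (real_of_rat q))"
      if "0 < q" "real_of_rat q < inverse (real (Suc k))" for q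
      using d(2)[of "real_of_rat q"] that measure_lebesgue_ball_pos[of "real_of_rat q" x]
      by (simp add: pos_divide_less_eq del: of_nat_Suc)
    then show "\<exists>k. \<forall>q. 0 < q \<and> real_of_rat q < inverse (real (Suc k)) \<longrightarrow>
     measure lebesgue (E \<inter> ball x (real_of_rat q)) \<le>
     inverse (real (Suc m)) * measure lebesgue (ball x (real_of_rat q))" by blast
  qed
next
  assume R: ?R
  show "zero_density E x"
    unfolding zero_density_def
  proof (rule order_tendstoI)
    fix e :: real assume e: "e > 0"
    then obtain m where m: "inverse (real (Suc m)) < e" using reals_Archimedean by blast
    obtain k where k: "\<And>q::rat. 0 < q \<Longrightarrow> real_of_rat q < inverse (real (Suc k)) \<Longrightarrow>
       measure lebesgue (E \<inter> ball x (real_of_rat q)) \<le>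
       inverse (real (Suc m)) * measure lebesgue (ball x (real_of_rat q))" using R by blast
    have "measure lebesgue (E \<inter> ball x r) / measure lebesgue (ball x r) < e"
      if r: "0 < r" "r < inverse (real (Suc k))" for r
    proof -
      have pos: "measure lebesgue (ball x r) > 0" using r measure_lebesgue_ball_pos by blast
      have "measure lebesgue (E \<inter> ball x r) \<le> inverse (real (Suc m)) * measure lebesgue (ball x r)"
      proof (rule ccontr)
        assume "\<not> ?thesis"
        then obtain s where s: "s < r"
          "inverse (real (Suc m)) * measure lebesgue (ball x r) < measure lebesgue (E \<inter> ball x s)"
          using measure_ball_Int_lsc[OF E] by (metis not_le)
        \<comment> \<open>The radius \<open>s\<close> is not known to be positive, while the
          countable condition speaks of positive rationals only.\<close>
        obtain q where q: "max 0 s < real_of_rat q" "real_of_rat q < r"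
          using of_rat_dense[of "max 0 s" r] s r by auto
        have "measure lebesgue (E \<inter> ball x s) \<le> measure lebesgue (E \<inter> ball x (real_of_rat q))"
          using q by (intro measure_Int_ball_mono E subset_ball) auto
        also have "\<dots> \<le> inverse (real (Suc m)) * measure lebesgue (ball x (real_of_rat q))"
          using q r by (intro k) auto
        also have "\<dots> \<le> inverse (real (Suc m)) * measure lebesgue (ball x r)"
          using measure_Int_ball_mono[of UNIV x "real_of_rat q" x r] q
          by (intro mult_left_mono) (auto simp: subset_ball)
        finally show False using s by simp
      qed
      also have "\<dots> < e * measure lebesgue (ball x r)" using m pos by simp
      finally show ?thesis using pos by (simp add: pos_divide_less_eq)
    qed
    then show "eventually (\<lambda>r. measure lebesgue (E \<inter> ball x r) / measure lebesgue (ball x r) < e) (at_right 0)"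
      unfolding eventually_at_right_field by (intro exI[of _ "inverse (real (Suc k))"]) auto
  next
    fix e :: real assume "e < 0"
    then show "eventually (\<lambda>r. e < measure lebesgue (E \<inter> ball x r) / measure lebesgue (ball x r)) (at_right 0)"
      by (intro always_eventually allI) (meson divide_nonneg_nonneg less_le_trans measure_nonneg)
  qed
qed

text \<open>It matters that the set is Borel: \<sigma> is a measure on Borel sets and may be
  singular to Lebesgue measure.\<close>

lemma sets_zero_density:
  fixes E :: "(real^'n::finite) set"
  assumes E: "E \<in> sets lebesgue"
  shows "{x. zero_density E x} \<in> sets borel"
proof -
  note [measurable] = borel_measurable_measure_Int_ball[OF E]
  have [measurable]: "(\<lambda>x::real^'n. measure lebesgue (ball x r)) \<in> borel_measurable borel" for r
    using borel_measurable_measure_Int_ball[of "UNIV :: (real^'n) set"] by simp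
  show ?thesis unfolding zero_density_iff_countable[OF E] by measurable
qed

lemma zero_density_mono:
  assumes "zero_density E x" "F \<subseteq> E" "E \<in> sets lebesgue" "F \<in> sets lebesgue"
  shows "zero_density F x"
  unfolding zero_density_def
proof (rule tendsto_sandwich[OF _ _ tendsto_const assms(1)[unfolded zero_density_def]])
  have "measure lebesgue (F \<inter> ball x r) \<le> measure lebesgue (E \<inter> ball x r)" for r
    using assms by (intro measure_mono_fmeasurable lmeasurable_Int_ball) auto
  then show "\<forall>\<^sub>F r in at_right 0. measure lebesgue (F \<inter> ball x r) / measure lebesgue (ball x r)
       \<le> measure lebesgue (E \<inter> ball x r) / measure lebesgue (ball x r)"
    by (intro always_eventually allI divide_right_mono) auto
qed auto

text \<open>In a small ball inside \<Omega> the two volume fractions add up to at least 1, so they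
  cannot both tend to 0.\<close>

lemma zero_density_Un_not_open:
  fixes E F :: "(real^'n::finite) set"
  assumes "open \<Omega>" "x \<in> \<Omega>" "E \<in> sets lebesgue" "F \<in> sets lebesgue"
    and cover: "AE y in lebesgue_on \<Omega>. y \<in> E \<union> F"
    and z: "zero_density E x" "zero_density F x"
  shows False
proof -
  let ?q = "\<lambda>E r. measure lebesgue (E \<inter> ball x r) / measure lebesgue (ball x r)"
  obtain d where d: "d > 0" "ball x d \<subseteq> \<Omega>" using assms open_contains_ball by blast
  have "((\<lambda>r. ?q E r + ?q F r) \<longlongrightarrow> 0 + 0) (at_right 0)"
    using z by (intro tendsto_add) (auto simp: zero_density_def)
  then have "eventually (\<lambda>r. ?q E r + ?q F r < 1) (at_right 0)"
    by (rule order_tendstoD(2)) simp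
  then obtain d' where d': "d' > 0" "\<And>r. 0 < r \<Longrightarrow> r < d' \<Longrightarrow> ?q E r + ?q F r < 1"
    unfolding eventually_at_right_field by auto
  define r where "r = min d d' / 2"
  have r: "0 < r" "r < d" "r < d'" using d d' by (auto simp: r_def)
  have \<Omega>: "\<Omega> \<in> sets lebesgue" using assms by auto
  have "measure lebesgue (ball x r) = measure lebesgue ((E \<union> F) \<inter> ball x r)"
  proof (rule measure_eq_AE)
    have "AE y in lebesgue. y \<in> \<Omega> \<longrightarrow> y \<in> E \<union> F"
      using cover AE_restrict_space_iff[of \<Omega> lebesgue] \<Omega> by simp
    moreover have "ball x r \<subseteq> \<Omega>" using d r subset_ball[of r d x] by auto
    ultimately show "AE y in lebesgue. (y \<in> ball x r) = (y \<in> (E \<union> F) \<inter> ball x r)"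
      by (auto elim!: eventually_mono)
  qed (use assms in auto)
  also have "\<dots> \<le> measure lebesgue (E \<inter> ball x r) + measure lebesgue (F \<inter> ball x r)"
    unfolding Int_Un_distrib2
    using assms by (intro measure_Un_le) auto
  finally have "1 \<le> ?q E r + ?q F r"
    using measure_lebesgue_ball_pos[OF r(1), of x] by (simp add: field_simps)
  then show False using d'(2)[OF r(1,3)] by simp
qed

section \<open>Approximate limits of bounded functions: bounds, measurability and order\<close>

lemma ap_upper_eq: "ap_upper \<Omega> u x = Inf {t. zero_density {y\<in>\<Omega>. u y > t} x}"
  by (simp add: ap_upper_def zero_density_def)

lemma ap_lower_eq: "ap_lower \<Omega> u x = Sup {t. zero_density {y\<in>\<Omega>. u y < t} x}"
  by (simp add: ap_lower_def zero_density_def)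

text \<open>Holds for every \<open>u\<close>, because the infimum of a real set is defined as minus
  the supremum of the reflected set. Facts about \<open>ap_lower\<close> thus follow from those
  about \<open>ap_upper\<close> for -u.\<close>

lemma ap_lower_eq_uminus_ap_upper: "ap_lower \<Omega> u x = - ap_upper \<Omega> (\<lambda>y. - u y) x"
proof -
  have "{t. zero_density {y\<in>\<Omega>. u y < t} x} = uminus ` {t. zero_density {y\<in>\<Omega>. - u y > t} x}"
  proof -
    have "{y\<in>\<Omega>. - u y > - t} = {y\<in>\<Omega>. u y < t}" for t by auto
    moreover have "{y\<in>\<Omega>. u y < - t} = {y\<in>\<Omega>. - u y > t}" for t by auto
    ultimately show ?thesis by (auto intro!: image_eqI[of t uminus "- t" for t])
  qed
  then show ?thesis by (simp add: ap_lower_eq ap_upper_eq Inf_real_def)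
qed

lemma zero_density_null:
  assumes "AE y in lebesgue_on \<Omega>. y \<notin> E" "E \<subseteq> \<Omega>" "\<Omega> \<in> sets lebesgue"
  shows "zero_density E x"
proof -
  have "AE y in lebesgue. y \<notin> E"
    using assms AE_restrict_space_iff[of \<Omega> lebesgue "\<lambda>y. y \<notin> E"] by (auto elim: eventually_mono)
  then obtain N where "E \<subseteq> N" "N \<in> null_sets lebesgue"
    by (auto simp: eventually_ae_filter)
  then have "E \<in> null_sets lebesgue" by (rule null_sets_completion_subset)
  then have "E \<inter> ball x r \<in> null_sets lebesgue" for r
    using null_sets_completion_subset[of "E \<inter> ball x r" E lborel] by simp
  then have "measure lebesgue (E \<inter> ball x r) = 0" for r
    by (simp add: measure_eq_0_null_sets)
  then show ?thesis by (simp add: zero_density_def)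
qed

text \<open>The set {u > C} is null, whereas for t < -C the set {u > t} is almost all of \<Omega>
  and cannot have density 0. So the levels that define \<open>ap_upper\<close> include C and are
  bounded below by -C.\<close>

lemma
  fixes u :: "real^'n::finite \<Rightarrow> real"
  assumes \<Omega>: "open \<Omega>" and u: "u \<in> borel_measurable (lebesgue_on \<Omega>)"
    and C: "AE y in lebesgue_on \<Omega>. \<bar>u y\<bar> \<le> C" and x: "x \<in> \<Omega>"
  shows zero_density_superlevel_bound: "zero_density {y\<in>\<Omega>. u y > C} x"
    and zero_density_superlevel_ge: "zero_density {y\<in>\<Omega>. u y > t} x \<Longrightarrow> - C \<le> t"
    and abs_ap_upper_le: "\<bar>ap_upper \<Omega> u x\<bar> \<le> C"
proof -
  have m: "{y\<in>\<Omega>. u y > t} \<in> sets lebesgue" for t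
    using u \<Omega> by (rule lebesgue_on_superlevel_set)
  have \<Omega>s: "\<Omega> \<in> sets lebesgue" using \<Omega> by auto
  show upper: "zero_density {y\<in>\<Omega>. u y > C} x"
    by (rule zero_density_null[where \<Omega>=\<Omega>]) (use C \<Omega>s in \<open>auto elim!: eventually_mono\<close>)
  have lower: "- C \<le> t" if z: "zero_density {y\<in>\<Omega>. u y > t} x" for t
  proof (rule ccontr)
    assume t: "\<not> ?thesis"
    have "AE y in lebesgue_on \<Omega>. y \<in> {y\<in>\<Omega>. u y > t} \<union> {}"
      using C AE_space by eventually_elim (use t in \<open>auto simp: space_restrict_space\<close>)
    then show False
      using zero_density_Un_not_open[OF \<Omega> x m _ _ z, of "{}"] by (simp add: zero_density_def)
  qed
  then show "zero_density {y\<in>\<Omega>. u y > t} x \<Longrightarrow> - C \<le> t" .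
  have "ap_upper \<Omega> u x \<le> C"
    unfolding ap_upper_eq using upper lower by (intro cInf_lower bdd_belowI[of _ "- C"]) auto
  moreover have "- C \<le> ap_upper \<Omega> u x"
    unfolding ap_upper_eq using upper lower by (intro cInf_greatest) auto
  ultimately show "\<bar>ap_upper \<Omega> u x\<bar> \<le> C" by simp
qed

lemma abs_ap_lower_le:
  fixes u :: "real^'n::finite \<Rightarrow> real"
  assumes "open \<Omega>" "u \<in> borel_measurable (lebesgue_on \<Omega>)" "AE y in lebesgue_on \<Omega>. \<bar>u y\<bar> \<le> C" "x \<in> \<Omega>"
  shows "\<bar>ap_lower \<Omega> u x\<bar> \<le> C"
  using abs_ap_upper_le[OF assms(1) borel_measurable_uminus[OF assms(2)] _ assms(4), of C] assms(3)
  by (simp add: ap_lower_eq_uminus_ap_upper)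

text \<open>Ensures that the infimum in \<open>ap_upper\<close> is a genuine one and that its levels
  form an upward closed set.\<close>

lemma zero_density_superlevel:
  fixes u :: "real^'n::finite \<Rightarrow> real"
  assumes \<Omega>: "open \<Omega>" and u: "Linf \<Omega> u" and x: "x \<in> \<Omega>"
  shows "{t. zero_density {y\<in>\<Omega>. u y > t} x} \<noteq> {}"
    and "bdd_below {t. zero_density {y\<in>\<Omega>. u y > t} x}"
    and "zero_density {y\<in>\<Omega>. u y > s} x \<Longrightarrow> s \<le> t \<Longrightarrow> zero_density {y\<in>\<Omega>. u y > t} x"
proof -
  have um: "u \<in> borel_measurable (lebesgue_on \<Omega>)" using u by (simp add: Linf_def)
  obtain C where C: "AE y in lebesgue_on \<Omega>. \<bar>u y\<bar> \<le> C" using u by (auto simp: Linf_def ess_bdd_def)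
  show "{t. zero_density {y\<in>\<Omega>. u y > t} x} \<noteq> {}"
    using zero_density_superlevel_bound[OF \<Omega> um C x] by auto
  show "bdd_below {t. zero_density {y\<in>\<Omega>. u y > t} x}"
    using zero_density_superlevel_ge[OF \<Omega> um C x] by (intro bdd_belowI) auto
  show "zero_density {y\<in>\<Omega>. u y > t} x" if z: "zero_density {y\<in>\<Omega>. u y > s} x" and st: "s \<le> t"
    by (rule zero_density_mono[OF z]) (use st lebesgue_on_superlevel_set[OF um \<Omega>] in auto)
qed

text \<open>The admissible levels are upward closed, so a rational one can be chosen below
  \<open>t\<close>; this turns sublevel sets of \<open>ap_upper\<close> into countable
  unions.\<close>

lemma ap_upper_less_iff:
  assumes "open \<Omega>" "Linf \<Omega> u" "x \<in> \<Omega>"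
  shows "ap_upper \<Omega> u x < t \<longleftrightarrow> (\<exists>q::rat. real_of_rat q < t \<and> zero_density {y\<in>\<Omega>. u y > real_of_rat q} x)"
proof
  assume "ap_upper \<Omega> u x < t"
  then obtain s where s: "s < t" "zero_density {y\<in>\<Omega>. u y > s} x"
    unfolding ap_upper_eq cInf_less_iff[OF zero_density_superlevel(1,2)[OF assms]] by auto
  obtain q where "s < real_of_rat q" "real_of_rat q < t" using of_rat_dense[OF s(1)] by blast
  then show "\<exists>q::rat. real_of_rat q < t \<and> zero_density {y\<in>\<Omega>. u y > real_of_rat q} x"
    using zero_density_superlevel(3)[OF assms s(2)] by (meson less_imp_le)
next
  assume "\<exists>q::rat. real_of_rat q < t \<and> zero_density {y\<in>\<Omega>. u y > real_of_rat q} x"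
  then show "ap_upper \<Omega> u x < t"
    unfolding ap_upper_eq cInf_less_iff[OF zero_density_superlevel(1,2)[OF assms]] by auto
qed

lemma Linf_uminus: "Linf \<Omega> u \<Longrightarrow> Linf \<Omega> (\<lambda>x. - u x)" for u :: "real^'n::finite \<Rightarrow> real"
  by (auto simp: Linf_def ess_bdd_def)

lemma borel_measurable_ap_upper:
  assumes \<Omega>: "open \<Omega>" and u: "Linf \<Omega> u" and M: "sets M = sets (restrict_space borel \<Omega>)"
  shows "ap_upper \<Omega> u \<in> borel_measurable M"
proof (rule borel_measurableI_less)
  fix t
  have sp: "space M = \<Omega>" using sets_eq_imp_space_eq[OF M] by (simp add: space_restrict_space)
  have "{y\<in>\<Omega>. u y > t} \<in> sets lebesgue" for t
    using u \<Omega> by (intro lebesgue_on_superlevel_set) (auto simp: Linf_def)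
  note s = sets_zero_density[OF this]
  have "(\<Union>q\<in>{q::rat. real_of_rat q < t}. {x. zero_density {y\<in>\<Omega>. u y > real_of_rat q} x}) \<in> sets borel"
    using s by (intro sets.countable_UN') auto
  moreover have "{x \<in> space M. ap_upper \<Omega> u x < t} =
      \<Omega> \<inter> (\<Union>q\<in>{q::rat. real_of_rat q < t}. {x. zero_density {y\<in>\<Omega>. u y > real_of_rat q} x})"
    using ap_upper_less_iff[OF \<Omega> u] sp by blast
  ultimately show "{x \<in> space M. ap_upper \<Omega> u x < t} \<in> sets M"
    unfolding M sets_restrict_space by (intro image_eqI) auto
qed

lemma borel_measurable_ap_lower:
  assumes "open \<Omega>" "Linf \<Omega> u" "sets M = sets (restrict_space borel \<Omega>)"
  shows "ap_lower \<Omega> u \<in> borel_measurable M"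
  unfolding ap_lower_eq_uminus_ap_upper
  by (intro borel_measurable_uminus borel_measurable_ap_upper Linf_uminus assms)

text \<open>Otherwise a level t strictly between the two would give rationals p < t < -q such that
  {u > p} and {u < -q} have density 0, although together they cover \<Omega>.\<close>

lemma ap_lower_le_ap_upper:
  assumes \<Omega>: "open \<Omega>" and u: "Linf \<Omega> u" and x: "x \<in> \<Omega>"
  shows "ap_lower \<Omega> u x \<le> ap_upper \<Omega> u x"
proof (rule ccontr)
  assume "\<not> ?thesis"
  then have "ap_upper \<Omega> u x < - ap_upper \<Omega> (\<lambda>y. - u y) x"
    by (simp add: ap_lower_eq_uminus_ap_upper)
  then obtain t where t: "ap_upper \<Omega> u x < t" "t < - ap_upper \<Omega> (\<lambda>y. - u y) x"
    using dense by blast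
  from t(2) have t': "ap_upper \<Omega> (\<lambda>y. - u y) x < - t" by simp
  obtain p q where pq: "real_of_rat p < t" "zero_density {y\<in>\<Omega>. u y > real_of_rat p} x"
     "real_of_rat q < - t" "zero_density {y\<in>\<Omega>. - u y > real_of_rat q} x"
    using t(1)[unfolded ap_upper_less_iff[OF \<Omega> u x]]
      t'[unfolded ap_upper_less_iff[OF \<Omega> Linf_uminus[OF u] x]] by blast
  have "AE y in lebesgue_on \<Omega>. y \<in> {y\<in>\<Omega>. u y > real_of_rat p} \<union> {y\<in>\<Omega>. - u y > real_of_rat q}"
    using pq by (auto intro!: AE_I2 simp: space_restrict_space)
  then show False
    using pq u Linf_uminus[OF u]
    by (intro zero_density_Un_not_open[OF \<Omega> x _ _ _ pq(2,4)] lebesgue_on_superlevel_set \<Omega>) (auto simp: Linf_def)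
qed

section \<open>Primitives and their suprema over intervals\<close>

abbreviation prim :: "(real \<Rightarrow> 'b::{banach, second_countable_topology}) \<Rightarrow> real \<Rightarrow> 'b" where
  "prim g t \<equiv> interval_lebesgue_integral lborel 0 (ereal t) g"

lemma set_integrable_bounded_interval:
  fixes g :: "real \<Rightarrow> 'b::{banach, second_countable_topology}"
  assumes [measurable]: "g \<in> borel_measurable borel" and g: "AE s in lborel. norm (g s) \<le> C"
  shows "set_integrable lborel {a<..<c} g"
  unfolding set_integrable_def
proof (rule Bochner_Integration.integrable_bound)
  have "integrable lborel (indicator {a<..<c} :: real \<Rightarrow> real)" by (cases "a \<le> c") auto
  then show "integrable lborel (\<lambda>s. C * indicator {a<..<c} s)" by (rule integrable_mult_right)
  show "AE s in lborel. norm (indicator {a<..<c} s *\<^sub>R g s) \<le> norm (C * indicator {a<..<c} s)"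
    using g by eventually_elim (auto split: split_indicator)
qed measurable

lemma norm_prim_diff_le:
  fixes g :: "real \<Rightarrow> 'b::{banach, second_countable_topology}"
  assumes [measurable]: "g \<in> borel_measurable borel" and g: "AE s in lborel. norm (g s) \<le> C"
  shows "norm (prim g s - prim g t) \<le> C * \<bar>s - t\<bar>"
proof -
  have int: "interval_lebesgue_integrable lborel (ereal a) (ereal c) g" for a c
    using set_integrable_bounded_interval[OF assms] by (simp add: interval_lebesgue_integrable_def)
  \<comment> \<open>Splitting the integral requires integrability over the hull of 0 and both
    endpoints, in whatever order they lie.\<close>
  have int0: "interval_lebesgue_integrable lborel (min 0 (min (ereal a) (ereal c))) (max 0 (max (ereal a) (ereal c))) g" for a c
    using int[of "min 0 (min a c)" "max 0 (max a c)"] by (simp add: zero_ereal_def del: ereal_min ereal_max flip: ereal_min ereal_max)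
  have *: "norm (prim g s - prim g t) \<le> C * (s - t)" if "t \<le> s" for s t
  proof -
    have "prim g t + interval_lebesgue_integral lborel (ereal t) (ereal s) g = prim g s"
      by (rule interval_integral_sum[OF int0])
    then have "prim g s - prim g t = interval_lebesgue_integral lborel (ereal t) (ereal s) g"
      by (metis add_diff_cancel_left')
    also have "\<dots> = (LINT x:{t<..<s}|lborel. g x)"
      using that by (simp add: interval_lebesgue_integral_def)
    finally have "norm (prim g s - prim g t) = norm (LINT x:{t<..<s}|lborel. g x)" by simp
    also have "\<dots> \<le> (LINT x:{t<..<s}|lborel. norm (g x))"
      by (rule set_integral_norm_bound[OF set_integrable_bounded_interval[OF assms]])
    also have "\<dots> \<le> (LINT x:{t<..<s}|lborel. C)"
      using set_integrable_norm[OF set_integrable_bounded_interval[OF assms], of t s] g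
        set_integrable_bounded_interval[of "\<lambda>_. C" "norm C" t s]
      unfolding set_lebesgue_integral_def set_integrable_def
      by (intro integral_mono_AE) (auto split: split_indicator)
    also have "\<dots> = C * (s - t)" using that by (simp add: set_lebesgue_integral_def mult.commute)
    finally show ?thesis .
  qed
  show ?thesis using *[of s t] *[of t s] by (cases "t \<le> s") (auto simp: norm_minus_commute)
qed

text \<open>Up to a constant this is the indefinite integral from \<open>p\<close>, which is
  continuous for every integrable \<open>g\<close>, bounded or not. Starting at \<open>p\<close>
  treats both signs of the argument at once.\<close>

lemma continuous_on_prim:
  fixes g :: "real \<Rightarrow> real"
  assumes "set_integrable lborel {p..q} g" "p \<le> 0" "0 \<le> q"
  shows "continuous_on {p..q} (prim g)"
proof -
  have si: "set_integrable lborel S g" if "S \<subseteq> {p..q}" "S \<in> sets borel" for S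
    using set_integrable_subset[OF assms(1)] that by auto
  have eq: "integral {p..t} g - integral {p..0} g = prim g t" if "t \<in> {p..q}" for t
  proof -
    have "interval_lebesgue_integrable lborel (min (ereal p) (min 0 (ereal t))) (max (ereal p) (max 0 (ereal t))) g"
    proof -
      have "max (ereal p) (max 0 (ereal t)) = (if 0 \<le> t then ereal t else 0)"
        "min (ereal p) (min 0 (ereal t)) = ereal p"
        using that assms by (auto simp: min_def max_def)
      moreover have "{p<..<t} \<subseteq> {p..q}" "{p<..<0} \<subseteq> {p..q}" using that assms by auto
      ultimately show ?thesis
        using si[of "{p<..<t}"] si[of "{p<..<0}"] that assms
        by (auto simp: interval_lebesgue_integrable_def zero_ereal_def)
    qed
    from interval_integral_sum[OF this]
    have "interval_lebesgue_integral lborel (ereal p) 0 g + prim g t = interval_lebesgue_integral lborel (ereal p) (ereal t) g" .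
    moreover have "interval_lebesgue_integral lborel (ereal p) 0 g = integral {p..0} g"
      using interval_integral_eq_integral[of p 0 g] si[of "{p..0}"] assms by (simp add: zero_ereal_def)
    moreover have "interval_lebesgue_integral lborel (ereal p) (ereal t) g = integral {p..t} g"
      using interval_integral_eq_integral[of p t g] si[of "{p..t}"] that by simp
    ultimately show ?thesis by simp
  qed
  have "g integrable_on {p..q}" using set_borel_integral_eq_integral(1)[OF assms(1)] .
  then have "continuous_on {p..q} (\<lambda>t. integral {p..t} g - integral {p..0} g)"
    by (intro continuous_intros indefinite_integral_continuous_1)
  then show ?thesis by (rule continuous_on_eq) (rule eq)
qed

text \<open>The integral of a non-integrable function is 0 by convention. The primitive integrates
  over the open interval; adding the two endpoints does not affect integrability.\<close>

lemma prim_eq_0_if_not_integrable: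
  fixes g :: "real \<Rightarrow> real"
  shows "0 \<le> t \<Longrightarrow> \<not> set_integrable lborel {0..t} g \<Longrightarrow> prim g t = 0"
    and "t \<le> 0 \<Longrightarrow> \<not> set_integrable lborel {t..0} g \<Longrightarrow> prim g t = 0"
proof -
  have *: "set_integrable lborel {a..c} g" if "set_integrable lborel {a<..<c} g" for a c :: real
    using that integrable_discrete_difference[of "{a,c}" lborel "\<lambda>x. indicator {a..c} x *\<^sub>R g x" "\<lambda>x. indicator {a<..<c} x *\<^sub>R g x"]
    unfolding set_integrable_def by (auto split: split_indicator)
  have 0: "(LINT x:{a<..<c}|lborel. g x) = 0" if "\<not> set_integrable lborel {a..c} g" for a c
    using *[of a c] that not_integrable_integral_eq unfolding set_integrable_def set_lebesgue_integral_def by blast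
  show "prim g t = 0" if "0 \<le> t" "\<not> set_integrable lborel {0..t} g"
    using that 0[OF that(2)] by (simp add: interval_lebesgue_integral_def zero_ereal_def)
  show "prim g t = 0" if "t \<le> 0" "\<not> set_integrable lborel {t..0} g"
    using that 0[OF that(2)]
    by (cases "t = 0") (simp_all add: interval_lebesgue_integral_def zero_ereal_def)
qed

text \<open>The open interval is placed beside t, to its right if possible, so that t may be an
  endpoint of the domain.\<close>

lemma continuous_on_gt_dense:
  fixes G :: "real \<Rightarrow> real"
  assumes "continuous_on {p..q} G" "p < q" "t \<in> {p..q}" "G t > z"
  obtains l r where "p \<le> l" "l < r" "r \<le> q" "\<And>s. l < s \<Longrightarrow> s < r \<Longrightarrow> G s > z"
proof -
  have "(G \<longlongrightarrow> G t) (at t within {p..q})" using assms by (auto simp: continuous_on_def)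
  then have "eventually (\<lambda>s. G s > z) (at t within {p..q})" using assms order_tendstoD(1) by blast
  then obtain d where d: "d > 0" "\<And>s. s \<in> {p..q} \<Longrightarrow> s \<noteq> t \<Longrightarrow> dist s t < d \<Longrightarrow> G s > z"
    unfolding eventually_at by auto
  show ?thesis
  proof (cases "t < q")
    case True
    show ?thesis
      by (rule that[of t "min q (t + d)"]) (use True d assms in \<open>auto simp: dist_real_def\<close>)
  next
    case False
    show ?thesis
      by (rule that[of "max p (t - d)" t]) (use False d assms in \<open>auto simp: dist_real_def\<close>)
  qed
qed

text \<open>Where \<open>g\<close> is not integrable its primitive has the junk value 0,
  and then one of the endpoints \<open>a\<close>, \<open>c\<close> carries that value too. Hence the supremum over an interval
  is a countable supremum for every \<open>x\<close>, not only almost every \<open>x\<close>.\<close>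
lemma prim_gt_rational:
  fixes g :: "real \<Rightarrow> real"
  assumes t: "t \<in> {a..c}" "prim g t > z"
  shows "\<exists>q\<in>\<rat> \<inter> {0..1}. prim g (a + q * (c - a)) > z"
proof -
  have a: ?thesis if "prim g a > z" using that by (intro bexI[of _ 0]) auto
  have c: ?thesis if "prim g c > z" using that by (intro bexI[of _ 1]) auto
  have cont: ?thesis if pq: "continuous_on {p..q} (prim g)" "p < q" "t \<in> {p..q}" "a \<le> p" "q \<le> c" for p q
  proof -
    obtain l r where lr: "p \<le> l" "l < r" "r \<le> q" "\<And>s. l < s \<Longrightarrow> s < r \<Longrightarrow> prim g s > z"
      using continuous_on_gt_dense[OF pq(1-3) t(2)] by metis
    have ca: "c - a > 0" using lr that by linarith
    have "(l - a) / (c - a) < (r - a) / (c - a)" using lr ca by (simp add: divide_strict_right_mono)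
    then obtain k where k: "k \<in> \<rat>" "(l - a) / (c - a) < k" "k < (r - a) / (c - a)"
      using Rats_dense_in_real by blast
    have k': "l < a + k * (c - a)" "a + k * (c - a) < r"
      using k ca by (auto simp: field_simps)
    moreover have "0 \<le> k" "k \<le> 1"
    proof -
      have "0 \<le> (l - a) / (c - a)" using lr that ca by auto
      then show "0 \<le> k" using k by linarith
      have "(r - a) / (c - a) \<le> 1" using lr that ca by auto
      then show "k \<le> 1" using k by linarith
    qed
    ultimately show ?thesis using lr(4) k(1) by (intro bexI[of _ k]) auto
  qed
  have sub: "set_integrable lborel {p'..q'} g" if "set_integrable lborel {p..q} g" "p \<le> p'" "q' \<le> q" for p q p' q'
    using set_integrable_subset[OF that(1)] that by auto
  \<comment> \<open>Away from the endpoints the cases follow the sign of t, since only integrability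
    between 0 and t matters. For t = 0 the interval \<open>{a..0}\<close> is used: either the
    primitive is continuous there, or it vanishes at \<open>a\<close> as it does at 0.\<close>
  consider "t = a" | "t = c" | "a < t" "0 < t" | "t < c" "t < 0" | "a < t" "t = 0" using t by force
  then show ?thesis
  proof cases
    case 3
    show ?thesis
    proof (cases "set_integrable lborel {0..t} g")
      case True
      then have "continuous_on {0..t} (prim g)" using 3 by (intro continuous_on_prim) auto
      then have "continuous_on {max a 0..t} (prim g)" by (rule continuous_on_subset) auto
      then show ?thesis using 3 t by (intro cont[of "max a 0" t]) auto
    next
      case False
      \<comment> \<open>Non-integrability up to t persists up to \<open>c\<close>, so both
        primitives have the default value 0 and the endpoint \<open>c\<close> serves.\<close>
      then have "\<not> set_integrable lborel {0..c} g" using 3 t sub[of 0 c 0 t] by auto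
      with False have "prim g c = prim g t"
        using 3 t by (simp add: prim_eq_0_if_not_integrable(1))
      then show ?thesis using c t by simp
    qed
  next
    case 4
    show ?thesis
    proof (cases "set_integrable lborel {t..0} g")
      case True
      then have "continuous_on {t..0} (prim g)" using 4 by (intro continuous_on_prim) auto
      then have "continuous_on {t..min c 0} (prim g)" by (rule continuous_on_subset) auto
      then show ?thesis using 4 t by (intro cont[of t "min c 0"]) auto
    next
      case False
      then have "\<not> set_integrable lborel {a..0} g" using 4 t sub[of a 0 t 0] by auto
      with False have "prim g a = prim g t"
        using 4 t by (simp add: prim_eq_0_if_not_integrable(2))
      then show ?thesis using a t by simp
    qed
  next
    case 5
    show ?thesis
    proof (cases "set_integrable lborel {a..0} g")
      case True
      then have "continuous_on {a..0} (prim g)" using 5 by (intro continuous_on_prim) auto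
      then show ?thesis using 5 t by (intro cont[of a 0]) auto
    next
      case False
      then have "prim g a = prim g t"
        using 5 by (auto simp: prim_eq_0_if_not_integrable(2) zero_ereal_def[symmetric])
      then show ?thesis using a t by simp
    qed
  qed (use a c t in auto)
qed

text \<open>The real supremum is defined through upper bounds alone, so it suffices that these
  agree, even for unbounded sets. Interpolating between \<open>a\<close> and \<open>c\<close> makes
  the index set independent of the interval, which later varies with x.\<close>

lemma Sup_prim_eq_countable_Sup:
  fixes g :: "real \<Rightarrow> real"
  assumes "a \<le> c"
  shows "Sup (prim g ` {a..c}) = Sup ((\<lambda>q. prim g (a + q * (c - a))) ` (\<rat> \<inter> {0..1}))"
proof -
  have "(\<forall>y\<in>prim g ` {a..c}. y \<le> z) \<longleftrightarrow> (\<forall>y\<in>(\<lambda>q. prim g (a + q * (c - a))) ` (\<rat> \<inter> {0..1}). y \<le> z)" for z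
  proof
    assume *: "\<forall>y\<in>prim g ` {a..c}. y \<le> z"
    have "a + q * (c - a) \<in> {a..c}" if "q \<in> {0..1}" for q
      using that assms mult_left_le_one_le[of "c - a" q] by auto
    then show "\<forall>y\<in>(\<lambda>q. prim g (a + q * (c - a))) ` (\<rat> \<inter> {0..1}). y \<le> z" using * by blast
  next
    assume *: "\<forall>y\<in>(\<lambda>q. prim g (a + q * (c - a))) ` (\<rat> \<inter> {0..1}). y \<le> z"
    have "prim g t \<le> z" if t: "t \<in> {a..c}" for t
    proof (rule ccontr)
      assume "\<not> ?thesis"
      then obtain q where "q \<in> \<rat> \<inter> {0..1}" "prim g (a + q * (c - a)) > z"
        using prim_gt_rational[OF t, of z g] by auto
      with * show False by force
    qed
    then show "\<forall>y\<in>prim g ` {a..c}. y \<le> z" by simp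
  qed
  then show ?thesis unfolding Sup_real_def by simp
qed

text \<open>The extended-real supremum is measurable, and the real one differs from it only where it
  is infinite; there it takes one fixed default value.\<close>

lemma borel_measurable_countable_Sup_real:
  fixes h :: "'i \<Rightarrow> 'a \<Rightarrow> real"
  assumes I: "countable I" "I \<noteq> {}" and [measurable]: "\<And>i. i \<in> I \<Longrightarrow> h i \<in> borel_measurable M"
  shows "(\<lambda>x. Sup ((\<lambda>i. h i x) ` I)) \<in> borel_measurable M"
proof -
  define S where "S x = (SUP i\<in>I. ereal (h i x))" for x
  \<comment> \<open>The value of the real supremum on a set without upper bound, where no z
    satisfies the defining property.\<close>
  define j where "j = (LEAST z::real. False)"
  have [measurable]: "S \<in> borel_measurable M"
    unfolding S_def using I(1) by (intro borel_measurable_SUP) auto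
  have "Sup ((\<lambda>i. h i x) ` I) = (if S x = \<infinity> then j else real_of_ereal (S x))" for x
  proof (cases "bdd_above ((\<lambda>i. h i x) ` I)")
    case True
    have "S x = ereal (Sup ((\<lambda>i. h i x) ` I))"
      unfolding S_def
    proof (rule SUP_eqI)
      show "ereal (h i x) \<le> ereal (Sup ((\<lambda>i. h i x) ` I))" if "i \<in> I" for i
        using cSUP_upper[OF that True] by simp
      show "ereal (Sup ((\<lambda>i. h i x) ` I)) \<le> y" if y: "\<And>i. i \<in> I \<Longrightarrow> ereal (h i x) \<le> y" for y
      proof (cases y)
        case (real r)
        then show ?thesis using cSUP_least[OF I(2), of "\<lambda>i. h i x" r] y by simp
      qed (use I(2) y in auto)
    qed
    then show ?thesis by simp
  next
    case False
    have "S x = \<infinity>"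
      unfolding S_def
    proof (rule SUP_PInfty)
      fix n :: nat
      show "\<exists>i\<in>I. ereal (real n) \<le> ereal (h i x)"
      proof (rule ccontr)
        assume "\<not> ?thesis"
        then have "\<And>i. i \<in> I \<Longrightarrow> h i x \<le> real n" by (simp add: not_le less_imp_le)
        then have "bdd_above ((\<lambda>i. h i x) ` I)" by (rule bdd_aboveI2)
        with False show False by simp
      qed
    qed
    moreover have "(\<forall>y\<in>(\<lambda>i. h i x) ` I. y \<le> z) = False" for z using False by (auto simp: bdd_above_def)
    ultimately show ?thesis by (simp only: Sup_real_def j_def simp_thms if_True)
  qed
  then show ?thesis by simp
qed

section \<open>Measurability in x of primitives and of \<open>Fhat\<close>\<close>

lemma borel_measurable_pair_restrict:
  fixes f :: "'a::second_countable_topology \<Rightarrow> real \<Rightarrow> 'b::topological_space"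
  assumes f: "(\<lambda>(x, t). f x t) \<in> borel_measurable (restrict_space borel (\<Omega> \<times> UNIV))"
    and M: "(\<lambda>x. x) \<in> M \<rightarrow>\<^sub>M borel" "space M \<subseteq> \<Omega>"
  shows "(\<lambda>(x, t). f x t) \<in> borel_measurable (M \<Otimes>\<^sub>M borel)"
proof -
  have [measurable]: "fst \<in> M \<Otimes>\<^sub>M (borel :: real measure) \<rightarrow>\<^sub>M borel"
    using measurable_compose[OF measurable_fst M(1)] .
  have "(\<lambda>p. (fst p, snd p)) \<in> M \<Otimes>\<^sub>M (borel :: real measure) \<rightarrow>\<^sub>M borel \<Otimes>\<^sub>M borel" by measurable
  then have "(\<lambda>p. p) \<in> M \<Otimes>\<^sub>M (borel :: real measure) \<rightarrow>\<^sub>M restrict_space borel (\<Omega> \<times> UNIV)"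
    using M(2) by (intro measurable_restrict_space2) (auto simp: space_pair_measure borel_prod)
  from measurable_compose[OF this f] show ?thesis .
qed

text \<open>The variable endpoint moves into the integrand as an indicator, which leaves a parameter
  integral against a fixed measure.\<close>

lemma borel_measurable_prim:
  fixes f :: "'a \<Rightarrow> real \<Rightarrow> 'b::{banach, second_countable_topology}"
  assumes [measurable]: "(\<lambda>(x, t). f x t) \<in> borel_measurable (M \<Otimes>\<^sub>M borel)" "v \<in> borel_measurable M"
  shows "(\<lambda>x. prim (f x) (v x)) \<in> borel_measurable M"
proof -
  have [measurable]: "(\<lambda>(x, t). f x t) \<in> borel_measurable (M \<Otimes>\<^sub>M lborel)"
    using assms(1) by (simp cong: measurable_cong_sets)
  have 1: "(\<lambda>x. LINT s|lborel. (if 0 < s \<and> s < v x then 1 else 0 :: real) *\<^sub>R f x s) \<in> borel_measurable M"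
    by measurable
  have 2: "(\<lambda>x. LINT s|lborel. (if v x < s \<and> s < 0 then 1 else 0 :: real) *\<^sub>R f x s) \<in> borel_measurable M"
    by measurable
  have "prim (f x) (v x) = (if 0 \<le> v x then LINT s|lborel. (if 0 < s \<and> s < v x then 1 else 0 :: real) *\<^sub>R f x s
      else - (LINT s|lborel. (if v x < s \<and> s < 0 then 1 else 0 :: real) *\<^sub>R f x s))" for x
    unfolding interval_lebesgue_integral_def set_lebesgue_integral_def
    by (auto simp: zero_ereal_def intro!: Bochner_Integration.integral_cong split: split_indicator)
  then show ?thesis using 1 2 by simp
qed

lemma borel_measurable_Fhat:
  assumes f: "(\<lambda>(x, t). f x t) \<in> borel_measurable (M \<Otimes>\<^sub>M borel)"
    and [measurable]: "a \<in> borel_measurable M" "c \<in> borel_measurable M"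
    and le: "\<And>x. x \<in> space M \<Longrightarrow> a x \<le> c x"
  shows "(\<lambda>x. Fhat f x (a x) (c x)) \<in> borel_measurable M"
proof -
  have "(\<lambda>x. Sup ((\<lambda>q. prim (f x) (a x + q * (c x - a x))) ` (\<rat> \<inter> {0..1}))) \<in> borel_measurable M"
  proof (rule borel_measurable_countable_Sup_real)
    show "countable (\<rat> \<inter> {0..1} :: real set)" using countable_rat by blast
    show "\<rat> \<inter> {0..1} \<noteq> ({} :: real set)" by (auto intro: exI[of _ 0])
    show "(\<lambda>x. prim (f x) (a x + q * (c x - a x))) \<in> borel_measurable M" for q
      by (intro borel_measurable_prim[OF f]) measurable
  qed
  moreover have "Fhat f x (a x) (c x) = Sup ((\<lambda>q. prim (f x) (a x + q * (c x - a x))) ` (\<rat> \<inter> {0..1}))"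
    if "x \<in> space M" for x
    using Sup_prim_eq_countable_Sup[OF le[OF that]] by (simp add: Fhat_def Fprim_def)
  ultimately show ?thesis by (simp cong: measurable_cong)
qed

section \<open>Lower semicontinuity\<close>

lemma continuous_on_grad:
  assumes "test_fun \<Omega> \<phi>"
  shows "continuous_on UNIV (grad \<phi>)"
proof -
  have "smooth_k (Suc 0) \<phi>" using assms unfolding test_fun_def by blast
  then have "continuous_on UNIV (pderiv_fun i \<phi>)" for i by simp
  then have "continuous_on UNIV (\<lambda>x. \<chi> i. pderiv_fun i \<phi> x)" by (intro continuous_on_vec_lambda)
  moreover have "grad \<phi> = (\<lambda>x. \<chi> i. pderiv_fun i \<phi> x)" by (simp add: grad_def fun_eq_iff)
  ultimately show ?thesis by simp
qed

lemma grad_eq_0_outside_support: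
  assumes "x \<notin> closure {x. \<phi> x \<noteq> 0}"
  shows "grad \<phi> x = 0"
proof -
  have "((\<lambda>_. 0) has_derivative (\<lambda>_. 0)) (at x)" by simp
  then have "(\<phi> has_derivative (\<lambda>_. 0)) (at x)"
  proof (rule has_derivative_transform_within_open[where s="- closure {x. \<phi> x \<noteq> 0}"])
    show "0 = \<phi> y" if "y \<in> - closure {x. \<phi> x \<noteq> 0}" for y
      using that closure_subset[of "{x. \<phi> x \<noteq> 0}"] by auto
  qed (use assms in auto)
  then show ?thesis by (simp add: grad_def vec_eq_iff pderiv_fun_eq)
qed

lemma bounded_if_compact_support:
  fixes h :: "'a::topological_space \<Rightarrow> 'b::real_normed_vector"
  assumes "compact K" "continuous_on UNIV h" "\<And>x. x \<notin> K \<Longrightarrow> h x = 0"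
  obtains B where "B \<ge> 0" "\<And>x. norm (h x) \<le> B"
proof -
  have "compact (h ` K)" using assms by (meson compact_continuous_image continuous_on_subset subset_UNIV)
  then have "bounded (insert 0 (h ` K))" by (simp add: compact_imp_bounded)
  then obtain B where B: "\<forall>y\<in>insert 0 (h ` K). norm y \<le> B" unfolding bounded_iff by blast
  have "norm (h x) \<le> B" for x using B assms(3)[of x] by (cases "x \<in> K") auto
  moreover have "B \<ge> 0" using B by simp
  ultimately show ?thesis using that by blast
qed

lemma test_fun_bounded:
  assumes "test_fun \<Omega> \<phi>"
  obtains B where "B \<ge> 0" "\<And>x. \<bar>\<phi> x\<bar> \<le> B"
proof -
  have "\<phi> x = 0" if "x \<notin> closure {x. \<phi> x \<noteq> 0}" for x
    using that closure_subset[of "{x. \<phi> x \<noteq> 0}"] by auto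
  moreover have "compact (closure {x. \<phi> x \<noteq> 0})" using assms by (simp only: test_fun_def)
  ultimately obtain B where "B \<ge> 0" "\<And>x. norm (\<phi> x) \<le> B"
    using bounded_if_compact_support[OF _ continuous_on_test_fun[OF assms]] by metis
  then show ?thesis using that by simp
qed

lemma grad_bounded:
  assumes "test_fun \<Omega> \<phi>"
  obtains B where "B \<ge> 0" "\<And>x. norm (grad \<phi> x) \<le> B"
  using bounded_if_compact_support[OF _ continuous_on_grad[OF assms] grad_eq_0_outside_support] assms
  unfolding test_fun_def by metis

lemma borel_measurable_section:
  assumes "(\<lambda>(x, t). f x t) \<in> borel_measurable (M \<Otimes>\<^sub>M borel)" "x \<in> space M"
  shows "f x \<in> borel_measurable borel"
  using measurable_compose[OF measurable_Pair1'[OF assms(2), of borel] assms(1)] by simp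

lemma lebesgue_on_id_measurable: "(\<lambda>x. x) \<in> lebesgue_on \<Omega> \<rightarrow>\<^sub>M borel"
  by (intro measurable_restrict_space1 measurable_completion) simp

lemma tendsto_integral_Bprim:
  fixes b :: "real^'n::finite \<Rightarrow> real \<Rightarrow> real^'n"
  assumes b: "(\<lambda>(x, t). b x t) \<in> borel_measurable (restrict_space borel (\<Omega> \<times> UNIV))"
    and C: "\<And>x t. x \<in> \<Omega> \<Longrightarrow> norm (b x t) \<le> C"
    and u: "integrable (lebesgue_on \<Omega>) u" and us: "\<And>n. integrable (lebesgue_on \<Omega>) (us n)"
    and lim: "(\<lambda>n. LINT x|lebesgue_on \<Omega>. \<bar>us n x - u x\<bar>) \<longlonglongrightarrow> 0"
    and \<phi>: "test_fun \<Omega> \<phi>"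
  shows "(\<lambda>n. LINT x|lebesgue_on \<Omega>. Bprim b x (us n x) \<bullet> grad \<phi> x)
     \<longlonglongrightarrow> (LINT x|lebesgue_on \<Omega>. Bprim b x (u x) \<bullet> grad \<phi> x)"
proof -
  obtain K where K: "K \<ge> 0" "\<And>x. norm (grad \<phi> x) \<le> K" using grad_bounded[OF \<phi>] by blast
  have sp: "space (lebesgue_on \<Omega>) = \<Omega>" by (simp add: space_restrict_space)
  have bm: "(\<lambda>(x, t). b x t) \<in> borel_measurable (lebesgue_on \<Omega> \<Otimes>\<^sub>M borel)"
    by (rule borel_measurable_pair_restrict[OF b lebesgue_on_id_measurable]) (simp add: sp)
  have lip: "norm (Bprim b x s - Bprim b x t) \<le> C * \<bar>s - t\<bar>" if "x \<in> \<Omega>" for x s t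
    unfolding Bprim_def
    using borel_measurable_section[OF bm] that C by (intro norm_prim_diff_le) (auto simp: sp)
  have gm: "grad \<phi> \<in> borel_measurable (lebesgue_on \<Omega>)"
    using measurable_compose[OF lebesgue_on_id_measurable borel_measurable_continuous_onI[OF continuous_on_grad[OF \<phi>]]] .
  have diff: "\<bar>Bprim b x s \<bullet> grad \<phi> x - Bprim b x t \<bullet> grad \<phi> x\<bar> \<le> C * K * \<bar>s - t\<bar>" if "x \<in> \<Omega>" for x s t
  proof -
    have "\<bar>(Bprim b x s - Bprim b x t) \<bullet> grad \<phi> x\<bar> \<le> norm (Bprim b x s - Bprim b x t) * norm (grad \<phi> x)"
      by (rule Cauchy_Schwarz_ineq2)
    also have "\<dots> \<le> (C * \<bar>s - t\<bar>) * K"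
      \<comment> \<open>The Lipschitz bound itself shows that C |s - t| is nonnegative, as
        multiplying the inequalities requires.\<close>
      using order_trans[OF norm_ge_zero lip[OF that]] by (intro mult_mono lip that K) auto
    finally show ?thesis by (simp add: inner_diff_left mult_ac)
  qed
  have int: "integrable (lebesgue_on \<Omega>) (\<lambda>x. Bprim b x (w x) \<bullet> grad \<phi> x)"
    if w: "integrable (lebesgue_on \<Omega>) w" for w
  proof (rule Bochner_Integration.integrable_bound)
    show "integrable (lebesgue_on \<Omega>) (\<lambda>x. C * K * \<bar>w x\<bar>)" using w by simp
    have "(\<lambda>x. Bprim b x (w x)) \<in> borel_measurable (lebesgue_on \<Omega>)"
      unfolding Bprim_def by (rule borel_measurable_prim[OF bm borel_measurable_integrable[OF w]])
    then show "(\<lambda>x. Bprim b x (w x) \<bullet> grad \<phi> x) \<in> borel_measurable (lebesgue_on \<Omega>)"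
      using gm by (rule borel_measurable_inner)
    show "AE x in lebesgue_on \<Omega>. norm (Bprim b x (w x) \<bullet> grad \<phi> x) \<le> norm (C * K * \<bar>w x\<bar>)"
    proof (rule AE_I2)
      fix x assume "x \<in> space (lebesgue_on \<Omega>)"
      then have "\<bar>Bprim b x (w x) \<bullet> grad \<phi> x\<bar> \<le> C * K * \<bar>w x\<bar>"
        \<comment> \<open>Comparison with the argument 0, where the primitive vanishes.\<close>
        using diff[of x "w x" 0] by (simp add: sp Bprim_def zero_ereal_def[symmetric])
      then show "norm (Bprim b x (w x) \<bullet> grad \<phi> x) \<le> norm (C * K * \<bar>w x\<bar>)" by simp
    qed
  qed
  show ?thesis
  proof (rule LIM_zero_cancel, rule Lim_null_comparison)
    show "(\<lambda>n. C * K * (LINT x|lebesgue_on \<Omega>. \<bar>us n x - u x\<bar>)) \<longlonglongrightarrow> 0"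
      using tendsto_mult_right_zero[OF lim] .
    show "\<forall>\<^sub>F n in sequentially. norm ((LINT x|lebesgue_on \<Omega>. Bprim b x (us n x) \<bullet> grad \<phi> x) -
        (LINT x|lebesgue_on \<Omega>. Bprim b x (u x) \<bullet> grad \<phi> x)) \<le> C * K * (LINT x|lebesgue_on \<Omega>. \<bar>us n x - u x\<bar>)"
    proof (intro always_eventually allI)
      fix n
      let ?d = "\<lambda>x. Bprim b x (us n x) \<bullet> grad \<phi> x - Bprim b x (u x) \<bullet> grad \<phi> x"
      have "norm ((LINT x|lebesgue_on \<Omega>. Bprim b x (us n x) \<bullet> grad \<phi> x) -
        (LINT x|lebesgue_on \<Omega>. Bprim b x (u x) \<bullet> grad \<phi> x)) = norm (LINT x|lebesgue_on \<Omega>. ?d x)"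
        using int[OF us] int[OF u] by simp
      also have "\<dots> \<le> (LINT x|lebesgue_on \<Omega>. norm (?d x))" by (rule integral_norm_bound)
      also have "\<dots> \<le> (LINT x|lebesgue_on \<Omega>. C * K * \<bar>us n x - u x\<bar>)"
      proof (rule integral_mono)
        show "integrable (lebesgue_on \<Omega>) (\<lambda>x. norm (?d x))"
          by (intro integrable_norm Bochner_Integration.integrable_diff int us u)
        show "integrable (lebesgue_on \<Omega>) (\<lambda>x. C * K * \<bar>us n x - u x\<bar>)" using u us by simp
        show "norm (?d x) \<le> C * K * \<bar>us n x - u x\<bar>" if "x \<in> space (lebesgue_on \<Omega>)" for x
          using diff[of x "us n x" "u x"] that by (simp add: sp)
      qed
      finally show "norm ((LINT x|lebesgue_on \<Omega>. Bprim b x (us n x) \<bullet> grad \<phi> x) -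
        (LINT x|lebesgue_on \<Omega>. Bprim b x (u x) \<bullet> grad \<phi> x)) \<le> C * K * (LINT x|lebesgue_on \<Omega>. \<bar>us n x - u x\<bar>)"
        by simp
    qed
  qed
qed

section \<open>Stability of \<open>Fhat\<close> at a fixed point\<close>

lemma Fhat_le:
  assumes "\<And>t. t \<in> {a..c} \<Longrightarrow> Fprim f x t \<le> z" "a \<le> c"
  shows "Fhat f x a c \<le> z"
  unfolding Fhat_def using assms by (intro cSUP_least) auto

text \<open>The Lipschitz bound is available only for \<sigma>-almost every x, so its consequences
  are stated at a fixed x and applied later under the almost-everywhere quantifier.\<close>

context
  fixes f :: "real^'n::finite \<Rightarrow> real \<Rightarrow> real" and x
  assumes lip: "\<And>s t. \<bar>Fprim f x s - Fprim f x t\<bar> \<le> \<bar>s - t\<bar>"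
begin

lemma abs_Fprim_le: "\<bar>Fprim f x t\<bar> \<le> \<bar>t\<bar>"
  using lip[of t 0] by (simp add: Fprim_def zero_ereal_def[symmetric])

lemma Fprim_le_Fhat:
  assumes "t \<in> {a..c}"
  shows "Fprim f x t \<le> Fhat f x a c"
  unfolding Fhat_def
proof (rule cSUP_upper[OF assms])
  have "Fprim f x s \<le> \<bar>a\<bar> + \<bar>c\<bar>" if "s \<in> {a..c}" for s
    using abs_Fprim_le[of s] that by auto
  then show "bdd_above (Fprim f x ` {a..c})" by (rule bdd_aboveI2)
qed

lemma abs_Fhat_le:
  assumes "a \<le> c" "\<bar>a\<bar> \<le> r" "\<bar>c\<bar> \<le> r"
  shows "\<bar>Fhat f x a c\<bar> \<le> r"
proof -
  have "Fprim f x t \<le> r" if "t \<in> {a..c}" for t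
    using abs_Fprim_le[of t] that assms by auto
  then have "Fhat f x a c \<le> r" using assms(1) by (rule Fhat_le)
  moreover have "- r \<le> Fhat f x a c"
    using Fprim_le_Fhat[of a a c] abs_Fprim_le[of a] assms by auto
  ultimately show ?thesis by simp
qed

text \<open>Clamping a point of [a', c'] to [a, c] moves it by at most e, and hence changes F(x, .)
  by at most e.\<close>

lemma Fhat_le_enlarged:
  assumes "a - e \<le> a'" "a' \<le> c'" "c' \<le> c + e" "a \<le> c" "0 \<le> e"
  shows "Fhat f x a' c' \<le> Fhat f x a c + e"
proof (rule Fhat_le)
  fix t assume t: "t \<in> {a'..c'}"
  define s where "s = max a (min c t)"
  have "s \<in> {a..c}" "\<bar>t - s\<bar> \<le> e" using t assms by (auto simp: s_def)
  then show "Fprim f x t \<le> Fhat f x a c + e"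
    using Fprim_le_Fhat[of s a c] lip[of t s] by auto
qed (use assms in auto)

text \<open>Eventually [a n, c n] lies in the e/2-enlargement of [a0, c0], which bounds its maximum
  from above only; the maximum with the limit value supplies the bound from below.\<close>

lemma tendsto_max_Fhat:
  assumes le: "\<And>n. a n \<le> c n" "a0 \<le> c0"
    and lim: "ereal a0 \<le> liminf (\<lambda>n. ereal (a n))" "limsup (\<lambda>n. ereal (c n)) \<le> ereal c0"
  shows "(\<lambda>n. max (Fhat f x (a n) (c n)) (Fhat f x a0 c0)) \<longlonglongrightarrow> Fhat f x a0 c0"
proof (rule tendstoI)
  fix e :: real assume e: "e > 0"
  have "ereal (a0 - e / 2) < liminf (\<lambda>n. ereal (a n))"
    using e by (intro less_le_trans[OF _ lim(1)]) simp
  then have "\<forall>\<^sub>F n in sequentially. ereal (a0 - e / 2) < ereal (a n)" by (rule less_LiminfD)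
  moreover have "limsup (\<lambda>n. ereal (c n)) < ereal (c0 + e / 2)"
    using e by (intro le_less_trans[OF lim(2)]) simp
  then have "\<forall>\<^sub>F n in sequentially. ereal (c n) < ereal (c0 + e / 2)" by (rule Limsup_lessD)
  ultimately show "\<forall>\<^sub>F n in sequentially. dist (max (Fhat f x (a n) (c n)) (Fhat f x a0 c0)) (Fhat f x a0 c0) < e"
  proof eventually_elim
    case (elim n)
    then have "Fhat f x (a n) (c n) \<le> Fhat f x a0 c0 + e / 2"
      using le e by (intro Fhat_le_enlarged) auto
    then show ?case using e by (auto simp: dist_real_def)
  qed
qed

end

text \<open>The null set of x where |f(x,t)| \<le> 1 fails depends on t. Exchanging the quantifiers
  gives, for almost every x, the bound for almost every t, which is all that the primitive
  sees.\<close>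

lemma AE_Fprim_Lipschitz:
  fixes b :: "real^'n::finite \<Rightarrow> real \<Rightarrow> real^'n"
  assumes \<Omega>: "open \<Omega>" and b3: "\<forall>t. DM_inf \<Omega> (\<lambda>x. b x t)"
    and b4: "lub_tv \<Omega> b \<sigma>" "finite_measure \<sigma>" and f: "RN_div_density \<Omega> b \<sigma> f"
    and fm: "(\<lambda>(x, t). f x t) \<in> borel_measurable (\<sigma> \<Otimes>\<^sub>M borel)"
  shows "AE x in \<sigma>. \<forall>s t. \<bar>Fprim f x s - Fprim f x t\<bar> \<le> \<bar>s - t\<bar>"
proof -
  have \<sigma>s: "sets \<sigma> = sets (restrict_space borel \<Omega>)" using b4(1) by (simp add: lub_tv_def)
  interpret \<sigma>: finite_measure \<sigma> by fact
  interpret pair_sigma_finite lborel \<sigma>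
    by (intro pair_sigma_finite.intro sigma_finite_lborel \<sigma>.sigma_finite_measure_axioms)
  have le1: "AE x in \<sigma>. \<bar>f x t\<bar> \<le> 1" for t
  proof -
    obtain \<nu> h where \<nu>: "div_polar \<Omega> (\<lambda>x. b x t) \<nu> h" 
      using spec[OF b3, of t] unfolding DM_inf_def div_tv_def by blast
    moreover have "emeasure \<nu> S \<le> emeasure \<sigma> S" if "S \<in> sets \<sigma>" for S
      using b4(1) \<nu> that unfolding lub_tv_def div_tv_def by blast
    ultimately show ?thesis
      using f by (intro div_density_abs_le_1[OF \<Omega> b4(2) \<sigma>s]) (auto simp: RN_div_density_def)
  qed
  have [measurable]: "(\<lambda>p. f (snd p) (fst p)) \<in> borel_measurable (lborel \<Otimes>\<^sub>M \<sigma>)"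
  proof -
    have "(\<lambda>p. (snd p, fst p)) \<in> lborel \<Otimes>\<^sub>M \<sigma> \<rightarrow>\<^sub>M \<sigma> \<Otimes>\<^sub>M borel" by measurable
    from measurable_compose[OF this fm] show ?thesis by simp
  qed
  have "{p \<in> space (lborel \<Otimes>\<^sub>M \<sigma>). \<bar>f (snd p) (fst p)\<bar> \<le> 1} \<in> sets (lborel \<Otimes>\<^sub>M \<sigma>)" by measurable
  from AE_commute[of "\<lambda>t x. \<bar>f x t\<bar> \<le> 1", OF this] le1
  have "AE x in \<sigma>. AE t in lborel. \<bar>f x t\<bar> \<le> 1" by simp
  then show ?thesis
    using AE_space
  proof eventually_elim
    case (elim x)
    have "\<bar>Fprim f x s - Fprim f x t\<bar> \<le> 1 * \<bar>s - t\<bar>" for s t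
      using norm_prim_diff_le[of "f x" 1 s t] elim borel_measurable_section[OF fm] by (simp add: Fprim_def)
    then show ?case by simp
  qed
qed

theorem theorem8p8:
  fixes \<Omega> :: "(real^'n::finite) set"
    and b :: "real^'n \<Rightarrow> real \<Rightarrow> real^'n"
    and \<sigma> :: "(real^'n) measure"
    and f :: "real^'n \<Rightarrow> real \<Rightarrow> real"
    and u :: "real^'n \<Rightarrow> real"
    and us :: "nat \<Rightarrow> real^'n \<Rightarrow> real"
    and \<phi> :: "real^'n \<Rightarrow> real"
  assumes dim: "CARD('n) \<ge> 2"
    and open_\<Omega>: "open \<Omega>"
    and b1_meas: "(\<lambda>(x, t). b x t) \<in> borel_measurable (restrict_space borel (\<Omega> \<times> UNIV))"
    and b1_bdd: "\<exists>C. \<forall>x\<in>\<Omega>. \<forall>t. norm (b x t) \<le> C"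
    and b2: "AE x in lebesgue_on \<Omega>. continuous_on UNIV (b x)"
    and b3: "\<forall>t. DM_inf \<Omega> (\<lambda>x. b x t)"
    and b4: "lub_tv \<Omega> b \<sigma>" "finite_measure \<sigma>"
    and f_def: "RN_div_density \<Omega> b \<sigma> f"
    and u_BV: "BV \<Omega> u" and u_Linf: "Linf \<Omega> u"
    and us_A: "class_A \<Omega> \<sigma> u us"
    and \<phi>_test: "test_fun \<Omega> \<phi>" and \<phi>_nonneg: "\<forall>x. \<phi> x \<ge> 0"
  shows "ereal (pairing_L \<Omega> \<sigma> b f u \<phi>) \<le> liminf (\<lambda>n. ereal (pairing_L \<Omega> \<sigma> b f (us n) \<phi>))"
proof -
  interpret \<sigma>: finite_measure \<sigma> by fact
  have \<sigma>s: "sets \<sigma> = sets (restrict_space borel \<Omega>)" using b4(1) by (simp add: lub_tv_def)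
  have sp: "space \<sigma> = \<Omega>" using sets_eq_imp_space_eq[OF \<sigma>s] by (simp add: space_restrict_space)
  have "(\<lambda>x. x) \<in> \<sigma> \<rightarrow>\<^sub>M borel"
    by (rule continuous_imp_measurable_restrict_borel[OF \<sigma>s]) simp
  then have fm: "(\<lambda>(x, t). f x t) \<in> borel_measurable (\<sigma> \<Otimes>\<^sub>M borel)"
    using f_def by (intro borel_measurable_pair_restrict[of f \<Omega>]) (auto simp: RN_div_density_def sp)
  have lip: "AE x in \<sigma>. \<forall>s t. \<bar>Fprim f x s - Fprim f x t\<bar> \<le> \<bar>s - t\<bar>"
    by (rule AE_Fprim_Lipschitz[OF open_\<Omega> b3 b4 f_def fm])
  obtain K where K: "K \<ge> 0" "\<And>x. \<bar>\<phi> x\<bar> \<le> K" using test_fun_bounded[OF \<phi>_test] by blast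
  have \<phi>m[measurable]: "\<phi> \<in> borel_measurable \<sigma>"
    by (intro continuous_imp_measurable_restrict_borel[OF \<sigma>s] continuous_on_test_fun[OF \<phi>_test])
  have us_Linf: "Linf \<Omega> (us n)" and us_BV: "BV \<Omega> (us n)" for n using us_A by (auto simp: class_A_def)
  define Fh where "Fh w x = Fhat f x (ap_lower \<Omega> w x) (ap_upper \<Omega> w x)" for w x
  have Fhm[measurable]: "Fh w \<in> borel_measurable \<sigma>" if "Linf \<Omega> w" for w
    unfolding Fh_def
    by (rule borel_measurable_Fhat[OF fm borel_measurable_ap_lower[OF open_\<Omega> that \<sigma>s]
          borel_measurable_ap_upper[OF open_\<Omega> that \<sigma>s]]) (simp add: sp ap_lower_le_ap_upper[OF open_\<Omega> that])
  obtain g where g: "integrable \<sigma> g"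
     "AE x in \<sigma>. \<forall>n. \<bar>ap_upper \<Omega> (us n) x\<bar> \<le> g x \<and> \<bar>ap_lower \<Omega> (us n) x\<bar> \<le> g x"
    using us_A by (auto simp: class_A_def)
  have Fn: "AE x in \<sigma>. \<forall>n. \<bar>Fh (us n) x\<bar> \<le> g x"
    using g(2) lip AE_space
  proof eventually_elim
    case (elim x)
    then show ?case
      unfolding Fh_def using ap_lower_le_ap_upper[OF open_\<Omega> us_Linf] sp by (intro allI abs_Fhat_le) auto
  qed
  obtain C where C: "AE y in lebesgue_on \<Omega>. \<bar>u y\<bar> \<le> C" using u_Linf by (auto simp: Linf_def ess_bdd_def)
  have um: "u \<in> borel_measurable (lebesgue_on \<Omega>)" using u_Linf by (simp add: Linf_def)
  have F0: "AE x in \<sigma>. \<bar>Fh u x\<bar> \<le> C"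
    using lip AE_space
  proof eventually_elim
    case (elim x)
    then show ?case
      unfolding Fh_def
      using ap_lower_le_ap_upper[OF open_\<Omega> u_Linf] abs_ap_upper_le[OF open_\<Omega> um C] abs_ap_lower_le[OF open_\<Omega> um C] sp
      by (intro abs_Fhat_le) auto
  qed
  have mx: "AE x in \<sigma>. (\<lambda>n. max (Fh (us n) x) (Fh u x)) \<longlonglongrightarrow> Fh u x"
  proof -
    have "AE x in \<sigma>. ereal (ap_lower \<Omega> u x) \<le> liminf (\<lambda>n. ereal (ap_lower \<Omega> (us n) x)) \<and>
        limsup (\<lambda>n. ereal (ap_upper \<Omega> (us n) x)) \<le> ereal (ap_upper \<Omega> u x)"
      using us_A by (auto simp: class_A_def elim: eventually_mono)
    then show ?thesis
      using lip AE_space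
    proof eventually_elim
      case (elim x)
      then show ?case
        unfolding Fh_def using ap_lower_le_ap_upper[OF open_\<Omega> us_Linf] ap_lower_le_ap_upper[OF open_\<Omega> u_Linf] sp
        by (intro tendsto_max_Fhat) auto
    qed
  qed
  \<comment> \<open>Where both almost-everywhere bounds hold, g and C are nonnegative, so g + C
    dominates each of the two values and their maximum; K bounds \<phi>.\<close>
  have dom: "integrable \<sigma> (\<lambda>x. K * (g x + C))" using g(1) by simp
  have bound: "\<bar>\<phi> x * y\<bar> \<le> K * (g x + C)" if "\<bar>y\<bar> \<le> g x + C" for x y
    unfolding abs_mult using that K by (intro mult_mono) auto
  have dct: "integrable \<sigma> (\<lambda>x. \<phi> x * max (Fh (us n) x) (Fh u x))"
    and dct_lim: "(\<lambda>n. LINT x|\<sigma>. \<phi> x * max (Fh (us n) x) (Fh u x)) \<longlonglongrightarrow> (LINT x|\<sigma>. \<phi> x * Fh u x)" for n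
  proof -
    note [measurable] = Fhm[OF us_Linf] Fhm[OF u_Linf]
    have 1: "AE x in \<sigma>. (\<lambda>n. \<phi> x * max (Fh (us n) x) (Fh u x)) \<longlonglongrightarrow> \<phi> x * Fh u x"
      using mx by eventually_elim (rule tendsto_mult_left)
    have 2: "AE x in \<sigma>. norm (\<phi> x * max (Fh (us n) x) (Fh u x)) \<le> K * (g x + C)" for n
      using Fn F0
    proof eventually_elim
      case (elim x)
      then have "\<bar>Fh (us n) x\<bar> \<le> g x" by blast
      with elim(2) show ?case unfolding real_norm_def by (intro bound) auto
    qed
    show "integrable \<sigma> (\<lambda>x. \<phi> x * max (Fh (us n) x) (Fh u x))"
      by (rule integrable_dominated_convergence2[OF _ _ dom 1 2]) measurable
    show "(\<lambda>n. LINT x|\<sigma>. \<phi> x * max (Fh (us n) x) (Fh u x)) \<longlonglongrightarrow> (LINT x|\<sigma>. \<phi> x * Fh u x)"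
      by (rule integral_dominated_convergence[OF _ _ dom 1 2]) measurable
  qed
  have Fn_int: "integrable \<sigma> (\<lambda>x. \<phi> x * Fh (us n) x)" for n
  proof (rule Bochner_Integration.integrable_bound[OF dom])
    show "(\<lambda>x. \<phi> x * Fh (us n) x) \<in> borel_measurable \<sigma>" using Fhm[OF us_Linf] by measurable
    show "AE x in \<sigma>. norm (\<phi> x * Fh (us n) x) \<le> norm (K * (g x + C))"
      using Fn F0
    proof eventually_elim
      case (elim x)
      then have "\<bar>Fh (us n) x\<bar> \<le> g x + C" by (meson abs_ge_zero add_increasing2 order_trans)
      from bound[OF this] show ?case by auto
    qed
  qed
  have le: "(LINT x|\<sigma>. \<phi> x * Fh (us n) x) \<le> (LINT x|\<sigma>. \<phi> x * max (Fh (us n) x) (Fh u x))" for n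
    using Fn_int dct \<phi>_nonneg by (intro integral_mono) (auto intro: mult_left_mono)
  obtain C' where "\<And>x t. x \<in> \<Omega> \<Longrightarrow> norm (b x t) \<le> C'" using b1_bdd by blast
  then have B: "(\<lambda>n. LINT x|lebesgue_on \<Omega>. Bprim b x (us n x) \<bullet> grad \<phi> x)
     \<longlonglongrightarrow> (LINT x|lebesgue_on \<Omega>. Bprim b x (u x) \<bullet> grad \<phi> x)"
    using u_BV us_BV us_A by (intro tendsto_integral_Bprim[OF b1_meas _ _ _ _ \<phi>_test]) (auto simp: BV_def class_A_def)
  \<comment> \<open>The term with the maximum carries a minus sign, so replacing it by the larger
    one lowers the pairing. Thus \<open>L n\<close> is a convergent minorant of the n-th pairing,
    and its limit is the pairing of \<open>u\<close>.\<close>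
  define L where "L n = - (LINT x|\<sigma>. \<phi> x * max (Fh (us n) x) (Fh u x))
      - (LINT x|lebesgue_on \<Omega>. Bprim b x (us n x) \<bullet> grad \<phi> x)" for n
  have "L \<longlonglongrightarrow> pairing_L \<Omega> \<sigma> b f u \<phi>"
    unfolding L_def pairing_L_def Fh_def[symmetric] by (intro tendsto_diff tendsto_minus dct_lim B)
  then have "liminf (\<lambda>n. ereal (L n)) = ereal (pairing_L \<Omega> \<sigma> b f u \<phi>)"
    by (intro lim_imp_Liminf) auto
  moreover have "L n \<le> pairing_L \<Omega> \<sigma> b f (us n) \<phi>" for n
    using le[of n] by (simp add: L_def pairing_L_def Fh_def[symmetric])
  ultimately show ?thesis
    using Liminf_mono[of "\<lambda>n. ereal (L n)" "\<lambda>n. ereal (pairing_L \<Omega> \<sigma> b f (us n) \<phi>)" sequentially]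
    by simp
qed

end
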